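(* Let $n\ge 3$, let $\lambda>0$, let $b,c\in\mathbb{R}$, let $q(y,z)=-y^3+b y^2 z+c y z^2$, and let $Q_N:\mathbb{R}^n\to\mathbb{R}^n$, $Q_N(x)=(q(x_1,x_n),q(x_2,x_1),\dots,q(x_n,x_{n-1}))$. Suppose that $Q_N$ is contracting. Consider the system $\dot x=\lambda x+Q_N(x)$ on its globally attracting invariant sphere, the flow there being identified with that of $\dot u=\mathcal{P}_N(u)$ on $S^{n-1}$, where $\mathcal{P}_N(u)=Q_N(u)-\langle Q_N(u),u\rangle u$. Indices are taken modulo $n$. (i) If $b^2+4(c+1)<0$ or $(b,c)=(0,-1)$, then the system has a heteroclinic network connecting the poles $\pm e_1,\pm e_2,\dots,\pm e_n$, with heteroclinic connections from $e_{i+1}$ to $e_i$ and to $-e_i$, and from $-e_{i+1}$ to $e_i$ and to $-e_i$, for every $i=1,\dots,n$. (ii) If $b^2+4(c+1)\ge 0$, $c\le -1$ and $(b,c)\ne(0,-1)$, then the system has one or two heteroclinic cycles (connecting poles), depending on the values of $b$ and $n$. Specifically: (ii.1) If $b<0$, there are two heteroclinic cycles $\{e_n,\dots,e_2,e_1\}$ and $\{-e_n,\dots,-e_2,-e_1\}$. (ii.2) If $b>0$ and $n$ is even, there are two heteroclinic cycles $\{e_n,-e_{n-1},\dots,e_2,-e_1\}$ and $\{-e_n,e_{n-1},\dots,-e_2,e_1\}$. (ii.3) If $b>0$ and $n$ is odd, there is one heteroclinic cycle $\{e_n,-e_{n-1},\dots,-e_2,e_1,-e_n,e_{n-1},\d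ots,e_2,-e_1\}$.
   Context: $\langle\cdot,\cdot\rangle$ is the Euclidean inner product, $S^{n-1}$ the unit sphere of $\mathbb{R}^n$, and $e_1,\dots,e_n$ the standard basis vectors; $\pm e_1,\dots,\pm e_n$ are called the poles and are equilibria of $\dot u=\mathcal{P}_N(u)$. A homogeneous polynomial map $Q$ is contracting if $\langle Q(u),u\rangle<0$ for every $u\in S^{n-1}$. By the invariant sphere theorem, if $Q_N$ is contracting then for every $\lambda>0$ the system $\dot x=\lambda x+Q_N(x)$ has a unique invariant topological $(n-1)$-sphere in $\mathbb{R}^n\setminus\{0\}$; it attracts all nonzero trajectories, and the flow on it is topologically equivalent to that of $\dot u=\mathcal{P}_N(u)$ on $S^{n-1}$. A heteroclinic connection from an equilibrium $p$ to an equilibrium $p'$ is a trajectory converging to $p$ as $t\to-\infty$ and to $p'$ as $t\to+\infty$. A heteroclinic cycle is a finite collection of equilibria $\{p_1,\dots,p_m\}$ and heteroclinic connections $\{\gamma_1,\dots,\gamma_m\}$, where $\gamma_i$ connects $p_i$ to $p_{i+1}$ for $i=1,\dots,m-1$ and $\gamma_m$ connects $p_m$ to $p_1$. A cycle is denoted by its list of equilibria, in the order in which they are connected. A heteroclinic network is a union of heteroclinic cycles that share some equilibria. *)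

theory Defs
  imports "HOL-Analysis.Analysis" "Berlekamp_Zassenhaus.Finite_Field"
begin

(* Vectors of R^n are written real ^ 'n mod_ring with n = CARD('n): the coordinates are
   indexed by the ring Z/n, so i + 1 and i - 1 are index arithmetic modulo n, and x_n is the
   coordinate with index of_nat n = 0. *)

definition cubic :: "real \<Rightarrow> real \<Rightarrow> real \<Rightarrow> real \<Rightarrow> real" where
  "cubic b c y z = - (y ^ 3) + b * y ^ 2 * z + c * y * z ^ 2"

definition cyclic_field :: "(real \<Rightarrow> real \<Rightarrow> real) \<Rightarrow> real ^ 'n::nontriv mod_ring \<Rightarrow> real ^ 'n mod_ring" where
  "cyclic_field q x = (\<chi> i. q (x $ i) (x $ (i - 1)))"

definition contracting :: "('v::euclidean_space \<Rightarrow> 'v) \<Rightarrow> bool" where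
  "contracting Q \<longleftrightarrow> (\<forall>u \<in> sphere 0 1. Q u \<bullet> u < 0)"

definition sphere_field :: "('v::euclidean_space \<Rightarrow> 'v) \<Rightarrow> 'v \<Rightarrow> 'v" where
  "sphere_field Q u = Q u - (Q u \<bullet> u) *\<^sub>R u"

definition poles :: "(real ^ 'n::nontriv mod_ring) set" where
  "poles = (\<Union>i. {axis i 1, - axis i 1})"

definition trajectory :: "('v::euclidean_space \<Rightarrow> 'v) \<Rightarrow> 'v set \<Rightarrow> (real \<Rightarrow> 'v) \<Rightarrow> bool" where
  "trajectory f M x \<longleftrightarrow> (\<forall>t. x t \<in> M \<and> (x has_vector_derivative f (x t)) (at t))"

definition equilibrium :: "('v::euclidean_space \<Rightarrow> 'v) \<Rightarrow> 'v set \<Rightarrow> 'v \<Rightarrow> bool" where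
  "equilibrium f M p \<longleftrightarrow> p \<in> M \<and> f p = 0"

definition attracting_invariant_sphere :: "('v::euclidean_space \<Rightarrow> 'v) \<Rightarrow> 'v set \<Rightarrow> bool" where
  "attracting_invariant_sphere f S \<longleftrightarrow>
     S homeomorphic sphere (0::'v) 1 \<and> 0 \<notin> S \<and>
     (\<forall>p\<in>S. \<exists>x. trajectory f S x \<and> x 0 = p) \<and>
     (\<forall>x. x 0 \<noteq> 0 \<and> (\<forall>t\<ge>0. (x has_vector_derivative f (x t)) (at t within {0..}))
        \<longrightarrow> ((\<lambda>t. infdist (x t) S) \<longlongrightarrow> 0) at_top)"

(* A strictly increasing surjective tau is an orientation-preserving change of time. *)
definition maps_orbits ::
  "('v::euclidean_space \<Rightarrow> 'v) \<Rightarrow> 'v set \<Rightarrow> ('v \<Rightarrow> 'v) \<Rightarrow> 'v set \<Rightarrow> ('v \<Rightarrow> 'v) \<Rightarrow> bool" where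
  "maps_orbits f M g N h \<longleftrightarrow>
     (\<forall>x. trajectory f M x \<longrightarrow>
        (\<exists>y \<tau>. trajectory g N y \<and> strict_mono (\<tau> :: real \<Rightarrow> real) \<and> surj \<tau> \<and>
               (\<forall>t. h (x t) = y (\<tau> t))))"

definition topological_equivalence ::
  "('v::euclidean_space \<Rightarrow> 'v) \<Rightarrow> 'v set \<Rightarrow> ('v \<Rightarrow> 'v) \<Rightarrow> 'v set \<Rightarrow> ('v \<Rightarrow> 'v) \<Rightarrow> bool" where
  "topological_equivalence f M g N h \<longleftrightarrow>
     (\<exists>h'. homeomorphism M N h h' \<and> maps_orbits f M g N h \<and> maps_orbits g N f M h')"

(* A constant trajectory at p converges to p in both time directions; it is not a connection. *)
definition heteroclinic_connection ::
  "('v::euclidean_space \<Rightarrow> 'v) \<Rightarrow> 'v set \<Rightarrow> 'v \<Rightarrow> 'v \<Rightarrow> (real \<Rightarrow> 'v) \<Rightarrow> bool" where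
  "heteroclinic_connection f M p p' x \<longleftrightarrow>
     equilibrium f M p \<and> equilibrium f M p' \<and>
     trajectory f M x \<and> \<not> x constant_on UNIV \<and>
     (x \<longlongrightarrow> p) at_bot \<and> (x \<longlongrightarrow> p') at_top"

type_synonym 'v cycle = "'v list \<times> (real \<Rightarrow> 'v) list"

(* xs ! i runs from ps ! i to its cyclic successor in ps. *)
definition heteroclinic_cycle :: "('v::euclidean_space \<Rightarrow> 'v) \<Rightarrow> 'v set \<Rightarrow> 'v cycle \<Rightarrow> bool" where
  "heteroclinic_cycle f M = (\<lambda>(ps, xs).
     ps \<noteq> [] \<and> distinct ps \<and> length xs = length ps \<and>
     (\<forall>i<length ps. heteroclinic_connection f M (ps ! i) (ps ! (Suc i mod length ps)) (xs ! i)))"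

definition cycle_connections :: "'v cycle \<Rightarrow> ('v \<times> (real \<Rightarrow> 'v) \<times> 'v) set" where
  "cycle_connections = (\<lambda>(ps, xs).
     {(ps ! i, xs ! i, ps ! (Suc i mod length ps)) | i. i < length ps})"

(* The cycles of a network are linked to each other by chains of cycles in which any two
   consecutive ones share an equilibrium. *)
definition heteroclinic_network ::
  "('v::euclidean_space \<Rightarrow> 'v) \<Rightarrow> 'v set \<Rightarrow> 'v cycle set \<Rightarrow> bool" where
  "heteroclinic_network f M \<C> \<longleftrightarrow>
     finite \<C> \<and> card \<C> \<ge> 2 \<and> (\<forall>C\<in>\<C>. heteroclinic_cycle f M C) \<and>
     (\<forall>C\<in>\<C>. \<forall>D\<in>\<C>.
        (C, D) \<in> {(A, B). A \<in> \<C> \<and> B \<in> \<C> \<and> set (fst A) \<inter> set (fst B) \<noteq> {}}\<^sup>*)"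

definition network_equilibria :: "'v cycle set \<Rightarrow> 'v set" where
  "network_equilibria \<C> = (\<Union>C\<in>\<C>. set (fst C))"

definition network_connections :: "'v cycle set \<Rightarrow> ('v \<times> (real \<Rightarrow> 'v) \<times> 'v) set" where
  "network_connections \<C> = (\<Union>C\<in>\<C>. cycle_connections C)"

(* A list of equilibria denotes the same cycle as any of its rotations. *)
definition cyclic_list :: "'a list \<Rightarrow> 'a list set" where
  "cyclic_list ps = range (\<lambda>k. rotate k ps)"

definition cycles_among :: "('v::euclidean_space \<Rightarrow> 'v) \<Rightarrow> 'v set \<Rightarrow> 'v set \<Rightarrow> 'v list set set" where
  "cycles_among f M P = cyclic_list ` {ps. set ps \<subseteq> P \<and> (\<exists>xs. heteroclinic_cycle f M (ps, xs))}"

end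

theory Submission
  imports Defs "HOL-Real_Asymp.Real_Asymp"
begin

text \<open>Near a pole \<open>e\<^sub>i\<close> every coordinate other than \<open>u\<^sub>i\<close> and \<open>u\<^sub>i\<^sub>+\<^sub>1\<close> satisfies a linear
  equation \<open>u\<^sub>j' = g u\<^sub>j\<close> with \<open>g \<longlongrightarrow> 1\<close>. So a trajectory that converges to \<open>\<plusminus>e\<^sub>i\<close> lies in the
  coordinate plane of \<open>e\<^sub>i\<close> and \<open>e\<^sub>i\<^sub>+\<^sub>1\<close>, also when \<open>c = -1\<close> and the pole is not hyperbolic. In that
  plane the ratio \<open>r = u\<^sub>i\<^sub>+\<^sub>1 / u\<^sub>i\<close> satisfies \<open>r' = u\<^sub>i\<^sup>2 r (c + 1 + b r - r\<^sup>2)\<close>. Hence there is a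
  connection from \<open>\<sigma>\<tau>e\<^sub>i\<^sub>+\<^sub>1\<close> to \<open>\<tau>e\<^sub>i\<close> exactly when the quadratic has no root of sign \<open>\<sigma>\<close>; the
  discriminant and the sign of \<open>b\<close> decide which signs occur. If only one sign does, every pole
  has exactly one predecessor among the poles, which determines all cycles. Connections are
  carried to the invariant sphere by the topological equivalence.\<close>

section \<open>Scalar differential equations\<close>

lemma antiderivative_exists:
  fixes g :: "real \<Rightarrow> real"
  assumes "\<And>t. isCont g t"
  obtains A where "\<And>t. (A has_real_derivative g t) (at t)"
proof -
  have "\<exists>A. \<forall>t::real. -\<infinity> < ereal t \<longrightarrow> ereal t < \<infinity> \<longrightarrow> (A has_vector_derivative g t) (at t)"
    by (rule einterval_antiderivative) (use assms in auto)
  then show thesis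
    using that by (auto simp: has_real_derivative_iff_has_vector_derivative)
qed

text \<open>With an antiderivative \<open>A\<close> of \<open>g\<close> as integrating factor,
  \<open>w t * exp (- A t)\<close> is constant. This makes coordinate hyperplanes and roots of the
  quadratic invariant.\<close>

lemma linear_ode_zero:
  fixes w g :: "real \<Rightarrow> real"
  assumes "\<And>t. isCont g t" and w: "\<And>t. (w has_real_derivative w t * g t) (at t)"
    and zero: "w t0 = 0"
  shows "w t = 0"
proof -
  obtain A where A: "\<And>t. (A has_real_derivative g t) (at t)"
    using antiderivative_exists assms(1) by blast
  have "((\<lambda>t. w t * exp (- A t)) has_real_derivative 0) (at t)" for t
    by (rule derivative_eq_intros w A refl | simp add: algebra_simps)+
  then have "w t * exp (- A t) = w t0 * exp (- A t0)"
    using DERIV_isconst_all by blast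
  then show ?thesis using zero by simp
qed

text \<open>Separation of variables: the solution is the inverse of the time function
  \<open>T\<close> with \<open>T' = 1 / H\<close>. The bound on \<open>H\<close> keeps the slope of
  \<open>T\<close> at most \<open>- 1 / K\<close>, so \<open>T\<close> maps onto the whole line and
  the solution exists for all time.\<close>

lemma decreasing_flow_exists:
  fixes H :: "real \<Rightarrow> real"
  assumes cont: "\<And>s. isCont H s" and neg: "\<And>s. H s < 0" and bound: "\<And>s. - K \<le> H s"
  obtains s where "\<And>t. (s has_real_derivative H (s t)) (at t)"
    and "filterlim s at_top at_bot" and "filterlim s at_bot at_top"
proof -
  have K: "K > 0" using neg[of 0] bound[of 0] by linarith
  have "isCont (\<lambda>s. 1 / H s) s" for s
    using neg[of s] by (intro continuous_intros cont) auto
  then obtain T where T: "\<And>s. (T has_real_derivative 1 / H s) (at s)"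
    using antiderivative_exists by blast
  have slope: "1 / H s \<le> - (1 / K)" for s
    using neg[of s] bound[of s] K by (simp add: divide_simps)
  have drop: "T y \<le> T x - (y - x) / K" if "x \<le> y" for x y
  proof -
    have "T y + y / K \<le> T x + x / K"
    proof (rule DERIV_nonpos_imp_nonincreasing[OF that])
      fix z
      have "((\<lambda>z. T z + z / K) has_real_derivative 1 / H z + 1 / K) (at z)"
        by (rule derivative_eq_intros T refl | use K in simp)+
      then show "\<exists>d. ((\<lambda>z. T z + z / K) has_real_derivative d) (at z) \<and> d \<le> 0"
        using slope[of z] by (intro exI[of _ "1 / H z + 1 / K"]) auto
    qed
    then show ?thesis by (simp add: diff_divide_distrib)
  qed
  have strict: "T y < T x" if "x < y" for x y
    using drop[of x y] that K by (smt (verit) divide_pos_pos)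
  have contT: "isCont T x" for x using T DERIV_isCont by blast
  have "\<exists>x. T x = t" for t
  proof -
    \<comment> \<open>By \<open>drop\<close>, going this far to the left of 0 raises
      \<open>T\<close> by at least \<open>\<bar>t\<bar> + \<bar>T 0\<bar>\<close>, enough to reach
      \<open>t\<close>; going as far to the right lowers it likewise.\<close>
    define a where "a = - (K * (\<bar>t\<bar> + \<bar>T 0\<bar>))"
    have a: "a \<le> 0" using K by (simp add: a_def)
    have "t \<le> T a" using drop[of a 0] a K by (simp add: a_def)
    moreover have "T (- a) \<le> t" using drop[of 0 "- a"] a K by (simp add: a_def)
    ultimately show ?thesis
      using IVT2[of T "- a" t a] contT a by auto
  qed
  then obtain s where s: "\<And>t. T (s t) = t" by metis
  have sT: "s (T x) = x" for x
    using s[of "T x"] strict[of "s (T x)" x] strict[of x "s (T x)"]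
    by (cases "s (T x)" x rule: linorder_cases) auto
  \<comment> \<open>A bound \<open>x\<close> on \<open>s\<close> becomes the bound
    \<open>T x\<close> on time, which settles both limits of \<open>s\<close>.\<close>
  have s_mono: "s t \<le> x \<longleftrightarrow> T x \<le> t" for t x
    using strict[of "s t" x] strict[of x "s t"] s[of t] by (cases "s t" x rule: linorder_cases) auto
  have s_mono': "x \<le> s t \<longleftrightarrow> t \<le> T x" for t x
    using strict[of "s t" x] strict[of x "s t"] s[of t] by (cases "s t" x rule: linorder_cases) auto
  have cont_s: "isCont s t" for t
  proof -
    have "isCont s (T (s t))"
      by (rule isCont_inverse_function[of 1]) (auto simp: sT contT)
    then show ?thesis by (simp add: s)
  qed
  have "(s has_real_derivative inverse (1 / H (s t))) (at t)" for t
    by (rule DERIV_inverse_function[where f = T and a = "t - 1" and b = "t + 1"])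
      (use T s cont_s neg[of "s t"] in auto)
  moreover have "filterlim s at_top at_bot"
    unfolding filterlim_at_top eventually_at_bot_linorder s_mono' by auto
  moreover have "filterlim s at_bot at_top"
    unfolding filterlim_at_bot eventually_at_top_linorder s_mono by auto
  ultimately show thesis using that[of s] by simp
qed

text \<open>Rolle on the whole line: \<open>\<bar>r\<bar>\<close> is below
  \<open>\<bar>r 0\<bar>\<close> outside a compact interval, so it attains a global maximum.\<close>

lemma vanishing_at_both_ends_imp_critical_point:
  fixes r r' :: "real \<Rightarrow> real"
  assumes der: "\<And>t. (r has_real_derivative r' t) (at t)"
    and "(r \<longlongrightarrow> 0) at_bot" "(r \<longlongrightarrow> 0) at_top" and nz: "\<And>t. r t \<noteq> 0"
  obtains t where "r' t = 0"
proof -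
  have ev: "eventually (\<lambda>t. \<bar>r t\<bar> < \<bar>r 0\<bar>) at_bot" "eventually (\<lambda>t. \<bar>r t\<bar> < \<bar>r 0\<bar>) at_top"
    using assms(2,3) nz[of 0] by (auto simp: tendsto_iff dist_real_def)
  from ev(1) obtain a where a: "\<And>t. t \<le> a \<Longrightarrow> \<bar>r t\<bar> < \<bar>r 0\<bar>"
    by (auto simp: eventually_at_bot_linorder)
  from ev(2) obtain b where b: "\<And>t. t \<ge> b \<Longrightarrow> \<bar>r t\<bar> < \<bar>r 0\<bar>"
    by (auto simp: eventually_at_top_linorder)
  have ab: "a < 0" "0 < b" using a[of 0] b[of 0] by (force simp: not_le[symmetric])+
  have contr: "continuous_on {a..b} (\<lambda>t. \<bar>r t\<bar>)"
    by (intro continuous_intros continuous_at_imp_continuous_on) (use der DERIV_isCont in blast)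
  obtain x where x: "x \<in> {a..b}" "\<And>y. y \<in> {a..b} \<Longrightarrow> \<bar>r y\<bar> \<le> \<bar>r x\<bar>"
    using continuous_attains_sup[OF _ _ contr] ab by fastforce
  have "\<bar>r 0\<bar> \<le> \<bar>r x\<bar>" using x(2)[of 0] ab by auto
  then have max: "\<bar>r y\<bar> \<le> \<bar>r x\<bar>" for y
    using x(2)[of y] a[of y] b[of y] by fastforce
  have "((\<lambda>t. (r t)\<^sup>2) has_real_derivative 2 * r x * r' x) (at x)"
    by (rule derivative_eq_intros der refl | simp)+
  then have "2 * r x * r' x = 0"
    by (rule DERIV_local_max[of _ _ _ 1]) (use max in \<open>auto simp: abs_le_square_iff[symmetric]\<close>)
  then show thesis using nz[of x] that by auto
qed

section \<open>Cycles of a relation\<close>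

lemma of_nat_mod_ring_eq_iff:
  "(of_nat a :: 'n::nontriv mod_ring) = of_nat b \<longleftrightarrow> a mod CARD('n) = b mod CARD('n)"
  unfolding of_nat_of_int_mod_ring by transfer (simp flip: zmod_int)

lemma mod_ring_eq_of_nat:
  fixes i :: "'n::nontriv mod_ring"
  obtains k where "k < CARD('n)" "i = of_nat k"
proof -
  have r: "to_int_mod_ring i \<in> {0..<int CARD('n)}"
    using range_to_int_mod_ring[where 'a = 'n] by blast
  have "i = of_nat (nat (to_int_mod_ring i))"
    unfolding of_nat_of_int_mod_ring using r by simp
  then show thesis using r by (intro that[of "nat (to_int_mod_ring i)"]) auto
qed

text \<open>Here n \<ge> 3 enters: 2 is nonzero in Z/n, so the coordinate that drives
  \<open>i\<close> differs from the one that \<open>i\<close> drives.\<close>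

lemma mod_ring_index_neq:
  fixes i :: "'n::nontriv mod_ring"
  assumes "CARD('n) \<ge> 3"
  shows "i - 1 \<noteq> i + 1" and "i + 1 \<noteq> i" and "i - 1 \<noteq> i"
proof -
  have "(of_nat 2 :: 'n mod_ring) \<noteq> of_nat 0"
    unfolding of_nat_mod_ring_eq_iff using assms by simp
  moreover have "(i + 1) - (i - 1) = 2" by (simp add: algebra_simps)
  ultimately show "i - 1 \<noteq> i + 1" by (metis diff_self of_nat_0 of_nat_numeral)
qed auto

text \<open>Keeps the combinatorics of cycles apart from the trajectories: \<open>R p q\<close>
  stands for the presence of a connection from \<open>p\<close> to \<open>q\<close>.\<close>

definition rel_cycle :: "('a \<Rightarrow> 'a \<Rightarrow> bool) \<Rightarrow> 'a list \<Rightarrow> bool" where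
  "rel_cycle R ps \<longleftrightarrow> ps \<noteq> [] \<and> distinct ps \<and>
     (\<forall>i<length ps. R (ps ! i) (ps ! (Suc i mod length ps)))"

lemma rel_cycle_rotate:
  assumes "rel_cycle R ps"
  shows "rel_cycle R (rotate k ps)"
proof -
  have "R (rotate k ps ! i) (rotate k ps ! (Suc i mod length ps))" if i: "i < length ps" for i
  proof -
    have "(k + Suc i mod length ps) mod length ps = Suc ((k + i) mod length ps) mod length ps"
      by (simp add: mod_simps)
    moreover have "(k + i) mod length ps < length ps" "Suc i mod length ps < length ps"
      using i by (auto intro: mod_less_divisor)
    ultimately show ?thesis
      using assms i by (simp add: rel_cycle_def nth_rotate)
  qed
  then show ?thesis using assms by (auto simp: rel_cycle_def)
qed

lemma cyclic_list_rotate: "cyclic_list (rotate k ps) = cyclic_list ps"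
proof -
  have "rotate j ps \<in> cyclic_list (rotate k ps)" for j
  proof (cases "ps = []")
    case False
    \<comment> \<open>After \<open>k\<close> steps, another \<open>k * (length ps - 1)\<close> steps
      complete \<open>k\<close> full turns, so a rotation is undone by a rotation.\<close>
    then have "rotate (j + k * (length ps - 1)) (rotate k ps) = rotate (j + k * length ps) ps"
      by (cases "length ps") (auto simp: rotate_rotate algebra_simps)
    also have "\<dots> = rotate j ps"
      by (metis mod_mult_self1 mult.commute rotate_conv_mod)
    finally show ?thesis unfolding cyclic_list_def by (metis rangeI)
  qed (auto simp: cyclic_list_def)
  then show ?thesis
    by (auto simp: cyclic_list_def rotate_rotate)
qed

lemma cyclic_list_set: "qs \<in> cyclic_list ps \<Longrightarrow> set qs = set ps"
  by (auto simp: cyclic_list_def)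

lemma mem_cyclic_list: "ps \<in> cyclic_list ps"
  unfolding cyclic_list_def by (metis rangeI rotate0 id_apply)

lemma cyclic_list_eq_imp_set_eq:
  assumes "cyclic_list ps = cyclic_list qs"
  shows "set ps = set qs"
  using mem_cyclic_list[of ps] unfolding assms by (rule cyclic_list_set)

text \<open>Predecessors are unique, so the lists agree when read backwards from the common last
  entry, as far as both reach. The closing step of the cycle then excludes different
  lengths.\<close>

lemma rel_cycle_eq_if_last_eq:
  assumes det: "\<And>p p' q. R p q \<Longrightarrow> R p' q \<Longrightarrow> p = p'"
    and ps: "rel_cycle R ps" and qs: "rel_cycle R qs" and last: "last ps = last qs"
  shows "ps = qs"
proof -
  have backward: "ps ! (length ps - Suc j) = qs ! (length qs - Suc j)"
    if "rel_cycle R ps" "rel_cycle R qs" "last ps = last qs"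
      "j < length ps" "j < length qs" for j ps qs
    using that(4,5)
  proof (induction j)
    case 0
    then show ?case using that by (auto simp: last_conv_nth)
  next
    case (Suc j)
    have "R (xs ! (length xs - Suc (Suc j))) (xs ! (length xs - Suc j))"
      if "rel_cycle R xs" "Suc j < length xs" for xs
    proof -
      have "Suc (length xs - Suc (Suc j)) mod length xs = length xs - Suc j"
        using that by (simp add: Suc_diff_Suc)
      moreover have "length xs - Suc (Suc j) < length xs" using that by simp
      ultimately show ?thesis using that(1) unfolding rel_cycle_def by fastforce
    qed
    from this[OF that(1) Suc.prems(1)] this[OF that(2) Suc.prems(2)]
    show ?case using det Suc.IH Suc.prems by simp
  qed
  \<comment> \<open>If \<open>ps\<close> were shorter, its first entry would be
    \<open>qs ! k\<close>. The predecessor of that point is \<open>last ps = last qs\<close> and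
    also \<open>qs ! (k - 1)\<close>, so \<open>qs\<close> would repeat an entry.\<close>
  have len: "\<not> length ps < length qs"
    if ps: "rel_cycle R ps" and qs: "rel_cycle R qs" and last: "last ps = last qs" for ps qs
  proof
    assume less: "length ps < length qs"
    define m k where "m = length ps" and "k = length qs - m"
    have m: "m \<ge> 1" using ps by (cases ps) (auto simp: rel_cycle_def m_def)
    have k: "1 \<le> k" "k < length qs" using less m by (auto simp: k_def m_def)
    have "ps ! 0 = qs ! k"
      using backward[OF ps qs last, of "m - 1"] m less by (simp add: m_def k_def)
    moreover have "R (ps ! (m - 1)) (ps ! 0)"
      using ps m unfolding rel_cycle_def m_def by (auto dest: spec[of _ "length ps - 1"])
    moreover have "Suc (k - 1) mod length qs = k" using k by simp
    then have "R (qs ! (k - 1)) (qs ! k)"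
      using qs k unfolding rel_cycle_def by (auto dest: spec[of _ "k - 1"])
    ultimately have "qs ! (k - 1) = ps ! (m - 1)" using det[of "qs ! (k - 1)" "qs ! k" "ps ! (m - 1)"] by simp
    also have "\<dots> = qs ! (length qs - 1)"
    proof -
      have "0 < length ps" "0 < length qs" using m less by (auto simp: m_def)
      then show ?thesis using backward[OF ps qs last, of 0] by (simp add: m_def)
    qed
    finally have "k - 1 = length qs - 1"
      using qs k less by (subst (asm) nth_eq_iff_index_eq) (auto simp: rel_cycle_def)
    then show False using k by simp
  qed
  have eq: "length ps = length qs"
    using len[OF ps qs last] len[OF qs ps last[symmetric]] by simp
  show ?thesis
  proof (rule nth_equalityI[OF eq])
    fix i assume "i < length ps"
    then show "ps ! i = qs ! i"
      using backward[OF ps qs last, of "length ps - Suc i"] eq by simp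
  qed
qed

text \<open>Both lists are rotated until the shared point \<open>x\<close> comes last.\<close>

lemma rel_cycle_same_class:
  assumes det: "\<And>p p' q. R p q \<Longrightarrow> R p' q \<Longrightarrow> p = p'"
    and ps: "rel_cycle R ps" and qs: "rel_cycle R qs" and x: "x \<in> set ps" "x \<in> set qs"
  shows "cyclic_list ps = cyclic_list qs"
proof -
  have ex: "\<exists>k. last (rotate k xs) = x" if mem: "x \<in> set xs" for xs
  proof -
    obtain ys zs where xs: "xs = ys @ x # zs"
      using split_list[OF mem] by blast
    have "rotate (length (ys @ [x])) xs = zs @ ys @ [x]"
      using rotate_append[of "ys @ [x]" zs] xs by simp
    then have "last (rotate (length (ys @ [x])) xs) = x" by simp
    then show ?thesis ..
  qed
  obtain k l where "last (rotate k ps) = x" "last (rotate l qs) = x"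
    using ex[OF x(1)] ex[OF x(2)] by blast
  then have "rotate k ps = rotate l qs"
    using rel_cycle_eq_if_last_eq[OF det rel_cycle_rotate[OF ps] rel_cycle_rotate[OF qs]] by simp
  then show ?thesis by (metis cyclic_list_rotate)
qed

text \<open>The first entry of any cycle has an outgoing step, so it lies on \<open>A\<close> or
  \<open>B\<close>, and a shared point forces the same class. Taking \<open>A = B\<close> yields a
  single class.\<close>

lemma rel_cycle_classes:
  assumes det: "\<And>p p' q. R p q \<Longrightarrow> R p' q \<Longrightarrow> p = p'"
    and A: "rel_cycle R A" and B: "rel_cycle R B"
    and cover: "\<And>p q. R p q \<Longrightarrow> p \<in> set A \<union> set B"
  shows "cyclic_list ` {ps. rel_cycle R ps} = {cyclic_list A, cyclic_list B}"
proof -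
  have "cyclic_list ps \<in> {cyclic_list A, cyclic_list B}" if ps: "rel_cycle R ps" for ps
  proof -
    have "ps ! 0 \<in> set ps" "ps ! 0 \<in> set A \<union> set B"
      using ps cover by (auto simp: rel_cycle_def)
    then show ?thesis
      using rel_cycle_same_class[OF det ps A] rel_cycle_same_class[OF det ps B] by auto
  qed
  then show ?thesis using A B by auto
qed

section \<open>Cycles that visit the indices in descending order\<close>

lemma nth_map_rev_upt:
  assumes "k < n"
  shows "map F (rev [1..<n+1]) ! k = F (n - k)"
  using assms by (subst nth_map) (auto simp: rev_nth Suc_diff_Suc simp del: upt_Suc)

lemma set_map_rev_upt: "set (map F (rev [1..<n+1])) = F ` {1..n}"
proof -
  have "{1..<n+1} = {1..n}" by auto
  then show ?thesis by (simp del: upt_Suc)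
qed

text \<open>The list is reversed because connections lead from index \<open>i + 1\<close> down to
  \<open>i\<close>; it starts at \<open>F n\<close>, so its closing step goes from
  \<open>F 1\<close> to \<open>F n\<close>.\<close>

lemma rel_cycle_rev_upt:
  assumes n: "n \<ge> 1" and inj: "inj_on F {1..n}"
    and step: "\<And>i. 1 \<le> i \<Longrightarrow> i < n \<Longrightarrow> R (F (Suc i)) (F i)" and close: "R (F 1) (F n)"
  shows "rel_cycle R (map F (rev [1..<n+1]))"
proof -
  define L where "L = map F (rev [1..<n+1])"
  have len: "length L = n" by (simp add: L_def)
  note nth = nth_map_rev_upt[of _ n F, folded L_def]
  have "{1..<n+1} = {1..n}" by auto
  then have "distinct L"
    using inj unfolding L_def distinct_map by (simp del: upt_Suc)
  moreover have "R (L ! k) (L ! (Suc k mod n))" if k: "k < n" for k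
  proof (cases "Suc k = n")
    case True
    then have "n - k = 1" "Suc k mod n = 0" by auto
    then show ?thesis using close nth[OF k] nth[of 0] n by simp
  next
    case False
    then have less: "Suc k < n" using k by simp
    then have "n - k = Suc (n - Suc k)" "Suc k mod n = Suc k" by auto
    then show ?thesis using step[of "n - Suc k"] nth[OF k] nth[OF less] less by simp
  qed
  ultimately have "rel_cycle R L" using n len by (auto simp: rel_cycle_def)
  then show ?thesis unfolding L_def .
qed

section \<open>Heteroclinic cycles as cycles of a relation\<close>

lemma rel_cycle_heteroclinic:
  "(\<exists>xs. heteroclinic_cycle f M (ps, xs)) \<longleftrightarrow>
     rel_cycle (\<lambda>p q. \<exists>x. heteroclinic_connection f M p q x) ps"
proof
  assume "rel_cycle (\<lambda>p q. \<exists>x. heteroclinic_connection f M p q x) ps"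
  then have ps: "ps \<noteq> []" "distinct ps"
    "\<forall>i\<in>{..<length ps}. \<exists>x. heteroclinic_connection f M (ps ! i) (ps ! (Suc i mod length ps)) x"
    unfolding rel_cycle_def by auto
  from bchoice[OF ps(3)] obtain X where
    "\<forall>i\<in>{..<length ps}. heteroclinic_connection f M (ps ! i) (ps ! (Suc i mod length ps)) (X i)" ..
  with ps have "heteroclinic_cycle f M (ps, map X [0..<length ps])"
    by (simp add: heteroclinic_cycle_def)
  then show "\<exists>xs. heteroclinic_cycle f M (ps, xs)" ..
qed (auto simp: heteroclinic_cycle_def rel_cycle_def)

text \<open>Every entry of a cycle is the source of a step, so the demand that it lie in
  \<open>P\<close> can be moved into the relation.\<close>

lemma cycles_among_rel_cycle:
  "cycles_among f M P = cyclic_list `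
     {ps. rel_cycle (\<lambda>p q. p \<in> P \<and> q \<in> P \<and> (\<exists>x. heteroclinic_connection f M p q x)) ps}"
proof -
  have "set ps \<subseteq> P \<and> rel_cycle S ps \<longleftrightarrow> rel_cycle (\<lambda>p q. p \<in> P \<and> q \<in> P \<and> S p q) ps" for S ps
  proof -
    have "p \<in> P" if "set ps \<subseteq> P" "i < length ps" "p = ps ! i" for p i
      using that nth_mem by blast
    moreover have "Suc i mod length ps < length ps" if "i < length ps" for i
      using that by (intro mod_less_divisor) auto
    ultimately show ?thesis
      unfolding rel_cycle_def by (auto simp: in_set_conv_nth)
  qed
  then show ?thesis
    unfolding cycles_among_def rel_cycle_heteroclinic by simp
qed

section \<open>Connections between poles\<close>

text \<open>The coordinate planes in which the connections between poles run; \<open>i\<close> is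
  the axis of the target pole.\<close>

definition planar :: "'n::nontriv mod_ring \<Rightarrow> real \<Rightarrow> real \<Rightarrow> real ^ 'n mod_ring" where
  "planar i w v = w *\<^sub>R axis i 1 + v *\<^sub>R axis (i + 1) 1"

lemma planar_nth:
  "planar i w v $ j = (if j = i then w else if j = i + 1 then v else 0)"
  by (auto simp: planar_def axis_def)

lemma inner_planar: "planar i w v \<bullet> planar i w' v' = w * w' + v * v'"
  by (simp add: planar_def inner_add_left inner_add_right inner_axis_axis)

text \<open>The plane is invariant because \<open>cubic b c 0 z = 0\<close>. Coordinate
  \<open>i\<close> is driven by coordinate \<open>i - 1\<close>, which is 0 here, and this leaves
  \<open>- (w ^ 3)\<close>.\<close>

lemma cyclic_field_planar:
  assumes "CARD('n::nontriv) \<ge> 3"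
  shows "cyclic_field (cubic b c) (planar i w v :: real ^ 'n mod_ring) =
    planar i (- (w ^ 3)) (cubic b c v w)"
  using mod_ring_index_neq[OF assms, of i]
  by (auto simp: vec_eq_iff cyclic_field_def planar_nth cubic_def)

lemma sphere_field_planar:
  fixes i :: "'n::nontriv mod_ring"
  assumes "CARD('n) \<ge> 3" and "k = v * cubic b c v w - w ^ 4"
  shows "sphere_field (cyclic_field (cubic b c)) (planar i w v) =
    planar i (- (w ^ 3) - k * w) (cubic b c v w - k * v)"
proof -
  have "cyclic_field (cubic b c) (planar i w v) \<bullet> planar i w v = k"
    unfolding cyclic_field_planar[OF assms(1)] inner_planar assms(2)
    by (simp add: algebra_simps eval_nat_numeral)
  then show ?thesis
    by (simp add: sphere_field_def cyclic_field_planar[OF assms(1)] vec_eq_iff planar_nth)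
qed

lemma poles_iff: "p \<in> poles \<longleftrightarrow> (\<exists>i. \<exists>s\<in>{1, - 1}. p = s *\<^sub>R axis i 1)"
  by (auto simp: poles_def)

lemma poles_subset_sphere: "poles \<subseteq> sphere 0 1"
  by (auto simp: poles_def)

lemma equilibrium_pole:
  fixes i :: "'n::nontriv mod_ring"
  assumes "CARD('n) \<ge> 3" and "s \<in> {1, - 1}"
  shows "equilibrium (sphere_field (cyclic_field (cubic b c))) (sphere 0 1) (s *\<^sub>R axis i 1)"
proof -
  have p: "s *\<^sub>R axis i 1 = planar i s 0" by (simp add: planar_def)
  have "sphere_field (cyclic_field (cubic b c)) (planar i s 0) = 0"
    using assms(2)
    by (subst sphere_field_planar[OF assms(1) refl]) (auto simp: planar_def cubic_def)
  then show ?thesis unfolding equilibrium_def p using assms(2) by (auto simp: norm_eq_sqrt_inner inner_planar)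
qed

lemma scaleR_axis_eq_iff:
  assumes "s \<noteq> (0::real)"
  shows "s *\<^sub>R axis i (1::real) = s' *\<^sub>R axis j 1 \<longleftrightarrow> i = j \<and> s = s'"
proof
  assume "s *\<^sub>R axis i (1::real) = s' *\<^sub>R axis j 1"
  then have "s = (if i = j then s' else 0)"
    by (auto simp: vec_eq_iff axis_def dest: spec[of _ i])
  then show "i = j \<and> s = s'" using assms by (auto split: if_splits)
qed auto

text \<open>The ratio \<open>r = v / w\<close> has no rest point of sign \<open>\<sigma>\<close>, so
  \<open>\<bar>r\<bar>\<close> falls from infinity, a pole on axis \<open>i + 1\<close>, to 0, a
  pole on axis \<open>i\<close>. As \<open>v = w * r\<close>, the source has sign
  \<open>\<sigma> * \<tau>\<close>.\<close>

lemma planar_connection_exists: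
  fixes i :: "'n::nontriv mod_ring"
  assumes n: "CARD('n) \<ge> 3" and sg: "\<sigma> \<in> {1, - 1}" "\<tau> \<in> {1, - 1}"
    and neg: "\<And>r. r > 0 \<Longrightarrow> c + 1 + b * (\<sigma> * r) - r\<^sup>2 < 0"
  obtains x where "heteroclinic_connection (sphere_field (cyclic_field (cubic b c))) (sphere 0 1)
    ((\<sigma> * \<tau>) *\<^sub>R axis (i + 1) 1) (\<tau> *\<^sub>R axis i 1) x"
proof -
  define H where "H = (\<lambda>s. (c + 1 + b * (\<sigma> * exp s) - (exp s)\<^sup>2) / (1 + (exp s)\<^sup>2))"
  have pos: "1 + (exp s)\<^sup>2 > 0" for s :: real by (simp add: add_pos_nonneg)
  have contH: "isCont H s" for s
    unfolding H_def using pos[of s] by (intro continuous_intros) auto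
  have negH: "H s < 0" for s
    unfolding H_def using neg[of "exp s"] pos[of s] by (simp add: divide_neg_pos)
  \<comment> \<open>Since \<open>e \<le> 1 + e\<^sup>2\<close>, each term of the numerator is
    bounded by a multiple of the denominator.\<close>
  have boundH: "- (1 + \<bar>b\<bar> + \<bar>c + 1\<bar>) \<le> H s" for s
  proof -
    define e where "e = exp s"
    have e: "0 \<le> e" "e \<le> 1 + e\<^sup>2"
      using zero_le_power2[of "e - 1"] by (auto simp: e_def power2_diff) (smt (verit) exp_gt_zero)
    have "- (b * (\<sigma> * e)) \<le> \<bar>b\<bar> * (1 + e\<^sup>2)"
    proof -
      have "- (b * (\<sigma> * e)) \<le> \<bar>b\<bar> * e"
        using sg(1) e(1) by (auto simp: abs_mult intro: order_trans[OF abs_ge_self] order_trans[OF abs_ge_minus_self])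
      also have "\<dots> \<le> \<bar>b\<bar> * (1 + e\<^sup>2)" using e(2) by (intro mult_left_mono) auto
      finally show ?thesis .
    qed
    moreover have "- (c + 1) \<le> \<bar>c + 1\<bar> * (1 + e\<^sup>2)"
      by (smt (verit) mult_left_mono[of 1 "1 + e\<^sup>2" "\<bar>c + 1\<bar>"] mult.right_neutral zero_le_power2)
    ultimately have "- ((1 + \<bar>b\<bar> + \<bar>c + 1\<bar>) * (1 + e\<^sup>2)) \<le> c + 1 + b * (\<sigma> * e) - e\<^sup>2"
      by (simp add: algebra_simps)
    then show ?thesis
      unfolding H_def using pos[of s] unfolding e_def[symmetric]
      by (simp only: pos_le_divide_eq mult_minus_left)
  qed
  obtain s where s: "\<And>t. (s has_real_derivative H (s t)) (at t)"
    and s_bot: "filterlim s at_top at_bot" and s_top: "filterlim s at_bot at_top"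
    using decreasing_flow_exists[OF contH negH boundH] by blast
  txt \<open>\<open>s = ln \<bar>r\<bar>\<close> turns the equation for the ratio into one with bounded negative right-hand
    side on the whole line; the time along the orbit is rescaled by \<open>u\<^sub>i\<^sup>2 = 1 / (1 + r\<^sup>2)\<close>.\<close>
  define r where "r = (\<lambda>t. \<sigma> * exp (s t))"
  define h where "h = (\<lambda>t. c + 1 + b * r t - (r t)\<^sup>2)"
  define a where "a = (\<lambda>t. 1 / sqrt (1 + (r t)\<^sup>2))"
  have r2: "(r t)\<^sup>2 = (exp (s t))\<^sup>2" for t using sg(1) by (auto simp: r_def)
  have pos_r: "1 + (r t)\<^sup>2 > 0" for t using pos r2 by simp
  have a2: "(a t)\<^sup>2 * (1 + (r t)\<^sup>2) = 1" for t
    using pos_r[of t] by (simp add: a_def power_divide)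
  have Ha: "H (s t) = h t * (a t)\<^sup>2" for t
    using pos_r[of t] by (simp add: H_def h_def a_def power_divide r2) (simp add: r_def)
  have r_der: "(r has_real_derivative r t * (h t * (a t)\<^sup>2)) (at t)" for t
    unfolding r_def by (rule derivative_eq_intros s refl | simp add: Ha)+
  have a_der: "(a has_real_derivative - (r t)\<^sup>2 * h t * (a t) ^ 5) (at t)" for t
  proof -
    have sq: "((\<lambda>t. sqrt (1 + (r t)\<^sup>2)) has_real_derivative
        (r t)\<^sup>2 * (h t * (a t)\<^sup>2) * a t) (at t)"
      using pos_r[of t]
      by - (rule r_der derivative_eq_intros refl | simp add: a_def power2_eq_square divide_simps)+
    have "(a has_real_derivative
        - ((r t)\<^sup>2 * (h t * (a t)\<^sup>2) * a t) * (a t)\<^sup>2) (at t)"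
      unfolding a_def using pos_r[of t]
      by - (rule sq[unfolded a_def] derivative_eq_intros refl | simp add: power2_eq_square divide_simps)+
    then show ?thesis by (simp add: algebra_simps eval_nat_numeral)
  qed
  \<comment> \<open>\<open>w\<close> and \<open>v\<close> are the coordinates of the unit vector
    with ratio \<open>r\<close> whose component along axis \<open>i\<close> has sign
    \<open>\<tau>\<close>.\<close>
  define w where "w = (\<lambda>t. \<tau> * a t)"
  define v where "v = (\<lambda>t. w t * r t)"
  have w2: "(w t)\<^sup>2 = (a t)\<^sup>2" for t using sg(2) by (auto simp: w_def)
  have norm1: "(w t)\<^sup>2 + (v t)\<^sup>2 = 1" for t
    using a2[of t] by (simp add: v_def power_mult_distrib w2 algebra_simps)
  define k where "k = (\<lambda>t. v t * cubic b c (v t) (w t) - w t ^ 4)"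
  \<comment> \<open>Multiplying \<open>w ^ 3\<close> by
    \<open>w\<^sup>2 * (1 + r\<^sup>2) = 1\<close> makes both sides homogeneous of degree 5 in
    \<open>w\<close>; the rest is a polynomial identity.\<close>
  have w_alg: "- (w ^ 3) - (v * cubic b c v w - w ^ 4) * w = w * (- r\<^sup>2 * h * w ^ 4)"
    if "w\<^sup>2 * (1 + r\<^sup>2) = 1" "v = w * r" "h = c + 1 + b * r - r\<^sup>2" for w v r h :: real
  proof -
    have "w ^ 3 = w ^ 3 * (w\<^sup>2 * (1 + r\<^sup>2))" by (simp add: that(1))
    also have "\<dots> = w ^ 5 + w ^ 5 * r\<^sup>2" by (simp add: algebra_simps eval_nat_numeral)
    finally have "- (w ^ 3) - (v * cubic b c v w - w ^ 4) * w =
        - (w ^ 5 + w ^ 5 * r\<^sup>2) - (v * cubic b c v w - w ^ 4) * w" by simp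
    also have "\<dots> = w * (- r\<^sup>2 * h * w ^ 4)"
      unfolding that(2,3) cubic_def by (simp add: algebra_simps eval_nat_numeral)
    finally show ?thesis .
  qed
  have v_alg: "(- (w ^ 3) - k * w) * r + w * (r * (h * w\<^sup>2)) = cubic b c v w - k * v"
    if "v = w * r" "h = c + 1 + b * r - r\<^sup>2" for w v r h k :: real
    unfolding that cubic_def by (simp add: algebra_simps eval_nat_numeral)
  have vt: "v t = w t * r t" and ht: "h t = c + 1 + b * r t - (r t)\<^sup>2" for t
    by (simp_all add: v_def h_def)
  have w_der: "(w has_real_derivative - (w t ^ 3) - k t * w t) (at t)" for t
  proof -
    have "(w has_real_derivative \<tau> * (- (r t)\<^sup>2 * h t * (a t) ^ 5)) (at t)"
      unfolding w_def by (rule derivative_eq_intros a_der refl | simp)+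
    moreover have "w t ^ 4 = a t ^ 4"
      using w2[of t] by (metis power2_eq_square power4_eq_xxxx mult.assoc)
    then have "\<tau> * (- (r t)\<^sup>2 * h t * (a t) ^ 5) = w t * (- (r t)\<^sup>2 * h t * w t ^ 4)"
      by (simp add: w_def eval_nat_numeral)
    moreover have "(w t)\<^sup>2 * (1 + (r t)\<^sup>2) = 1" using a2 w2 by simp
    note w_alg[OF this vt ht, folded k_def]
    ultimately show ?thesis unfolding k_def by metis
  qed
  have v_der: "(v has_real_derivative cubic b c (v t) (w t) - k t * v t) (at t)" for t
  proof -
    have "(v has_real_derivative (- (w t ^ 3) - k t * w t) * r t + w t * (r t * (h t * (w t)\<^sup>2))) (at t)"
      unfolding v_def w2 by (rule derivative_eq_intros w_der r_der refl | simp)+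
    then show ?thesis using v_alg[OF vt[of t] ht[of t], of "k t"] by simp
  qed
  define x where "x = (\<lambda>t. planar i (w t) (v t))"
  have x_der: "(x has_vector_derivative planar i w' v') (at t)"
    if "(w has_real_derivative w') (at t)" "(v has_real_derivative v') (at t)" for t w' v'
    unfolding x_def planar_def
    by (intro has_vector_derivative_add)
      (use that in \<open>auto simp: has_real_derivative_iff_has_vector_derivative
        intro: bounded_linear.has_vector_derivative[OF bounded_linear_scaleR_left]\<close>)
  have "(x has_vector_derivative sphere_field (cyclic_field (cubic b c)) (x t)) (at t)" for t
  proof -
    have "sphere_field (cyclic_field (cubic b c)) (x t) =
        planar i (- (w t ^ 3) - k t * w t) (cubic b c (v t) (w t) - k t * v t)"
      unfolding x_def by (rule sphere_field_planar[OF n]) (simp add: k_def)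
    then show ?thesis using x_der[OF w_der v_der] by simp
  qed
  moreover have "x t \<in> sphere 0 1" for t
    using norm1[of t] by (simp add: x_def norm_eq_sqrt_inner inner_planar power2_eq_square)
  ultimately have traj: "trajectory (sphere_field (cyclic_field (cubic b c))) (sphere 0 1) x"
    by (simp add: trajectory_def)
  \<comment> \<open>Written in \<open>s\<close>, the coordinates have elementary limits. As
    \<open>s\<close> decreases in time, its limit at \<open>at_top\<close> describes the source and
    that at \<open>at_bot\<close> the target.\<close>
  have w_eq: "w = (\<lambda>t. (\<lambda>s. \<tau> / sqrt (1 + (exp s)\<^sup>2)) (s t))"
    and v_eq: "v = (\<lambda>t. (\<lambda>s. \<tau> * \<sigma> * (exp s / sqrt (1 + (exp s)\<^sup>2))) (s t))"
    by (auto simp: fun_eq_iff v_def w_def a_def r2) (auto simp: r_def)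
  have "((\<lambda>s. \<tau> / sqrt (1 + (exp s)\<^sup>2)) \<longlongrightarrow> 0) at_top" by real_asymp
  then have w_bot: "(w \<longlongrightarrow> 0) at_bot"
    unfolding w_eq by (rule filterlim_compose[OF _ s_bot])
  have "((\<lambda>s. \<tau> / sqrt (1 + (exp s)\<^sup>2)) \<longlongrightarrow> \<tau>) at_bot" by real_asymp
  then have w_top: "(w \<longlongrightarrow> \<tau>) at_top"
    unfolding w_eq by (rule filterlim_compose[OF _ s_top])
  have "((\<lambda>s::real. exp s / sqrt (1 + (exp s)\<^sup>2)) \<longlongrightarrow> 1) at_top" by real_asymp
  then have "((\<lambda>s. \<tau> * \<sigma> * (exp s / sqrt (1 + (exp s)\<^sup>2))) \<longlongrightarrow> \<tau> * \<sigma> * 1) at_top"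
    by (intro tendsto_intros)
  then have v_bot: "(v \<longlongrightarrow> \<tau> * \<sigma> * 1) at_bot"
    unfolding v_eq by (rule filterlim_compose[OF _ s_bot])
  have "((\<lambda>s::real. exp s / sqrt (1 + (exp s)\<^sup>2)) \<longlongrightarrow> 0) at_bot" by real_asymp
  then have "((\<lambda>s. \<tau> * \<sigma> * (exp s / sqrt (1 + (exp s)\<^sup>2))) \<longlongrightarrow> \<tau> * \<sigma> * 0) at_bot"
    by (intro tendsto_intros)
  then have v_top: "(v \<longlongrightarrow> \<tau> * \<sigma> * 0) at_top"
    unfolding v_eq by (rule filterlim_compose[OF _ s_top])
  have x_bot: "(x \<longlongrightarrow> (\<sigma> * \<tau>) *\<^sub>R axis (i + 1) 1) at_bot"
    unfolding x_def planar_def by (rule tendsto_eq_intros w_bot v_bot refl | simp)+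
  have x_top: "(x \<longlongrightarrow> \<tau> *\<^sub>R axis i 1) at_top"
    unfolding x_def planar_def by (rule tendsto_eq_intros w_top v_top refl | simp)+
  have "\<not> x constant_on UNIV"
  proof
    assume "x constant_on UNIV"
    then obtain y where "x = (\<lambda>_. y)" by (auto simp: constant_on_def fun_eq_iff)
    then have "(\<sigma> * \<tau>) *\<^sub>R axis (i + 1) 1 = \<tau> *\<^sub>R axis i (1::real)"
      using x_bot x_top by (simp add: tendsto_const_iff)
    then show False using sg scaleR_axis_eq_iff[of "\<sigma> * \<tau>" "i + 1" \<tau> i] by auto
  qed
  moreover have "\<sigma> * \<tau> \<in> {1, - 1}" using sg by auto
  ultimately show thesis
    using that[of x] traj x_bot x_top equilibrium_pole[OF n] sg
    unfolding heteroclinic_connection_def by blast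
qed

section \<open>Necessary conditions for a connection between poles\<close>

lemma continuous_cyclic_field_inner:
  fixes u :: "real ^ 'n::nontriv mod_ring"
  shows "isCont (\<lambda>x. cyclic_field (cubic b c) x \<bullet> x) u"
  unfolding inner_vec_def cyclic_field_def cubic_def
  by (auto intro!: continuous_intros)

text \<open>Once \<open>g > 0\<close>, \<open>w\<^sup>2\<close> is nondecreasing, so tending to 0
  forces \<open>w T = 0\<close>; a solution of the linear equation with one zero vanishes
  identically.\<close>

lemma tendsto_zero_imp_eq_zero:
  fixes w g :: "real \<Rightarrow> real"
  assumes cont: "\<And>t. isCont g t" and w: "\<And>t. (w has_real_derivative w t * g t) (at t)"
    and g: "(g \<longlongrightarrow> 1) at_top" and lim: "(w \<longlongrightarrow> 0) at_top"
  shows "w t = 0"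
proof -
  have "eventually (\<lambda>t. g t > 0) at_top"
    using g by (rule order_tendstoD) simp
  then obtain T where T: "\<And>t. t \<ge> T \<Longrightarrow> g t > 0"
    by (auto simp: eventually_at_top_linorder)
  have "(w T)\<^sup>2 \<le> (w t)\<^sup>2" if "t \<ge> T" for t
  proof (rule DERIV_nonneg_imp_nondecreasing[OF that])
    fix z assume "T \<le> z"
    have "((\<lambda>t. (w t)\<^sup>2) has_real_derivative 2 * (w z)\<^sup>2 * g z) (at z)"
      by (rule derivative_eq_intros w refl | simp add: power2_eq_square)+
    then show "\<exists>y. ((\<lambda>t. (w t)\<^sup>2) has_real_derivative y) (at z) \<and> 0 \<le> y"
      using T[OF \<open>T \<le> z\<close>] by (intro exI conjI) auto
  qed
  then have "eventually (\<lambda>t. (w T)\<^sup>2 \<le> (w t)\<^sup>2) at_top"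
    by (auto simp: eventually_at_top_linorder)
  moreover have "((\<lambda>t. (w t)\<^sup>2) \<longlongrightarrow> 0\<^sup>2) at_top" by (intro tendsto_intros lim)
  ultimately have "(w T)\<^sup>2 \<le> 0\<^sup>2"
    by (intro tendsto_lowerbound) auto
  then have "w T = 0" by simp
  then show ?thesis using linear_ode_zero[OF cont w] by blast
qed

text \<open>Converse to \<open>planar_connection_exists\<close>. \<open>\<sigma>\<close> is the sign
  of the ratio \<open>r\<close>, which sweeps through every value of that sign and cannot meet a
  root on the way.\<close>

lemma connection_between_poles:
  fixes i :: "'n::nontriv mod_ring"
  assumes n: "CARD('n) \<ge> 3" and sg: "\<tau> \<in> {1, - 1}" and p: "p \<in> poles"
    and con: "heteroclinic_connection (sphere_field (cyclic_field (cubic b c))) (sphere 0 1)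
      p (\<tau> *\<^sub>R axis i 1) x"
  shows "\<exists>\<sigma>\<in>{1, - 1}. p = (\<sigma> * \<tau>) *\<^sub>R axis (i + 1) 1 \<and>
    (\<forall>r>0. c + 1 + b * (\<sigma> * r) - r\<^sup>2 \<noteq> 0)"
proof -
  let ?Q = "cyclic_field (cubic b c) :: real ^ 'n mod_ring \<Rightarrow> _"
  have x_der: "(x has_vector_derivative sphere_field ?Q (x t)) (at t)" for t
    using con by (auto simp: heteroclinic_connection_def trajectory_def)
  have x_bot: "(x \<longlongrightarrow> p) at_bot" and x_top: "(x \<longlongrightarrow> \<tau> *\<^sub>R axis i 1) at_top"
    and nonconst: "\<not> x constant_on UNIV"
    using con by (auto simp: heteroclinic_connection_def trajectory_def)
  define k where "k = (\<lambda>t. ?Q (x t) \<bullet> x t)"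
  \<comment> \<open>\<open>cubic b c y z\<close> has the factor \<open>y\<close>, so along the given
    trajectory each coordinate obeys a linear equation with coefficient \<open>g j\<close>.\<close>
  define g where "g = (\<lambda>j t. - (x t $ j)\<^sup>2 + b * (x t $ j) * (x t $ (j - 1)) + c * (x t $ (j - 1))\<^sup>2 - k t)"
  have x_cont: "isCont x t" for t
    using x_der has_vector_derivative_continuous by blast
  have k_cont: "isCont k t" for t
    unfolding k_def using continuous_at_compose[OF x_cont continuous_cyclic_field_inner]
    by (simp add: o_def)
  have g_cont: "isCont (g j) t" for j t
    unfolding g_def by (intro continuous_intros x_cont k_cont)
  have comp_der: "((\<lambda>t. x t $ j) has_real_derivative x t $ j * g j t) (at t)" for j t
  proof -
    have "sphere_field ?Q (x t) $ j = x t $ j * g j t"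
      by (simp add: sphere_field_def cyclic_field_def cubic_def g_def k_def power2_eq_square
          power3_eq_cube algebra_simps)
    then show ?thesis
      using bounded_linear.has_vector_derivative[OF bounded_linear_vec_nth x_der, of j t]
      by (simp add: has_real_derivative_iff_has_vector_derivative)
  qed
  have comp_zero: "x t $ j = 0" if "x t0 $ j = 0" for j t t0
    by (rule linear_ode_zero[where w = "\<lambda>t. x t $ j", OF g_cont comp_der that])
  have top: "((\<lambda>t. x t $ j) \<longlongrightarrow> (if j = i then \<tau> else 0)) at_top" for j
    using tendsto_vec_nth[OF x_top, of j] by (simp add: axis_def split: if_splits)
  have pole: "\<tau> *\<^sub>R axis i 1 = planar i \<tau> 0" by (simp add: planar_def)
  have "?Q (\<tau> *\<^sub>R axis i 1) \<bullet> (\<tau> *\<^sub>R axis i 1) = - 1"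
    unfolding pole cyclic_field_planar[OF n] inner_planar using sg by auto
  then have k_top: "(k \<longlongrightarrow> - 1) at_top"
    using isCont_tendsto_compose[OF continuous_cyclic_field_inner x_top, of b c]
    unfolding k_def by metis
  \<comment> \<open>At the target \<open>k\<close> tends to \<open>- 1\<close> while
    \<open>x t $ j\<close> and \<open>x t $ (j - 1)\<close> tend to 0, so \<open>g j\<close> tends
    to 1. For \<open>j = i + 1\<close> the driving coordinate tends to \<open>\<tau>\<close>
    instead, which is why that axis can survive.\<close>
  have off: "x t $ j = 0" if "j \<noteq> i" "j \<noteq> i + 1" for j t
  proof (rule tendsto_zero_imp_eq_zero[where w = "\<lambda>t. x t $ j", OF g_cont comp_der])
    have j: "j - 1 \<noteq> i" using that by (metis diff_add_cancel)
    have "(g j \<longlongrightarrow> - 0\<^sup>2 + b * 0 * 0 + c * 0\<^sup>2 - (- 1)) at_top"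
      unfolding g_def using top[of j] top[of "j - 1"] that j
      by (intro tendsto_intros k_top) simp_all
    then show "(g j \<longlongrightarrow> 1) at_top" by simp
    show "((\<lambda>t. x t $ j) \<longlongrightarrow> 0) at_top" using top[of j] that by simp
  qed
  note idx = mod_ring_index_neq[OF n, of i]
  define w v where "w = (\<lambda>t. x t $ i)" and "v = (\<lambda>t. x t $ (i + 1))"
  have x_planar: "x t = planar i (w t) (v t)" for t
    using off[of _ t] by (auto simp: vec_eq_iff planar_nth w_def v_def)
  have w_nz: "w t \<noteq> 0" for t
  proof
    assume "w t = 0"
    then have "w = (\<lambda>_. 0)" using comp_zero by (auto simp: w_def fun_eq_iff)
    moreover have "(w \<longlongrightarrow> \<tau>) at_top" using top[of i] by (simp add: w_def)
    ultimately show False using sg by (auto simp: tendsto_const_iff)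
  qed
  \<comment> \<open>If \<open>v\<close> vanished once, it would vanish always; the trajectory would
    consist of equilibria on axis \<open>i\<close> and be constant.\<close>
  have v_nz: "v t \<noteq> 0" for t
  proof
    assume "v t = 0"
    then have v0: "v s = 0" for s using comp_zero unfolding v_def by blast
    have "(w s)\<^sup>2 = 1" for s
    proof -
      have "norm (x s) = 1"
        using con by (auto simp: heteroclinic_connection_def trajectory_def)
      then have "planar i (w s) (v s) \<bullet> planar i (w s) (v s) = 1"
        by (simp only: norm_eq_1 x_planar[of s, symmetric])
      then show ?thesis by (simp add: inner_planar v0 power2_eq_square)
    qed
    then have "w s \<in> {1, - 1}" for s by (simp add: power2_eq_1_iff)
    then have "sphere_field ?Q (x s) = 0" for s
      using equilibrium_pole[OF n, of "w s" b c i] x_planar[of s] v0[of s]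
      by (simp add: equilibrium_def planar_def)
    then have "(x has_vector_derivative 0) (at s)" for s using x_der[of s] by simp
    then obtain y where "\<And>s. x s = y"
      using has_vector_derivative_zero_constant[of UNIV x] by auto
    then show False using nonconst by (auto simp: constant_on_def)
  qed
  define r where "r = (\<lambda>t. v t / w t)"
  have r_nz: "r t \<noteq> 0" for t using w_nz v_nz by (simp add: r_def)
  have w_der: "(w has_real_derivative w t * (- (w t)\<^sup>2 - k t)) (at t)" for t
  proof -
    have "g i t = - (w t)\<^sup>2 - k t"
      using off[of "i - 1" t] idx by (simp add: g_def w_def)
    then show ?thesis using comp_der[of i t] by (simp add: w_def)
  qed
  have v_der: "(v has_real_derivative v t * (- (v t)\<^sup>2 + b * v t * w t + c * (w t)\<^sup>2 - k t)) (at t)" for t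
    using comp_der[of "i + 1" t] by (simp add: v_def w_def g_def)
  have r_der: "(r has_real_derivative r t * ((w t)\<^sup>2 * (c + 1 + b * r t - (r t)\<^sup>2))) (at t)" for t
  proof -
    have "(r has_real_derivative
      (v t * (- (v t)\<^sup>2 + b * v t * w t + c * (w t)\<^sup>2 - k t) * w t -
       v t * (w t * (- (w t)\<^sup>2 - k t))) / (w t * w t)) (at t)"
      unfolding r_def by (rule DERIV_divide v_der w_der w_nz)+
    moreover have "(v t * (- (v t)\<^sup>2 + b * v t * w t + c * (w t)\<^sup>2 - k t) * w t -
       v t * (w t * (- (w t)\<^sup>2 - k t))) / (w t * w t) = r t * ((w t)\<^sup>2 * (c + 1 + b * r t - (r t)\<^sup>2))"
      using w_nz[of t] by (simp add: r_def field_simps power2_eq_square)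
    ultimately show ?thesis by simp
  qed
  have w_cont: "isCont w t" and v_cont: "isCont v t" and r_cont: "isCont r t" for t
    using w_der v_der r_der DERIV_isCont by blast+
  have r_top: "(r \<longlongrightarrow> 0) at_top"
  proof -
    have "(r \<longlongrightarrow> 0 / \<tau>) at_top"
      unfolding r_def w_def v_def using top[of i] top[of "i + 1"] sg idx
      by (intro tendsto_divide) auto
    then show ?thesis by simp
  qed
  txt \<open>A root of the quadratic is an equilibrium of the equation for \<open>r\<close>, so \<open>r\<close> never attains it.\<close>
  have no_root: "r t \<noteq> \<rho>" if \<rho>: "c + 1 + b * \<rho> - \<rho>\<^sup>2 = 0" for \<rho> t
  proof
    assume hit: "r t = \<rho>"
    have C: "isCont (\<lambda>s. - (r s * (w s)\<^sup>2 * (r s - (b - \<rho>)))) s" for s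
      by (intro continuous_intros r_cont w_cont)
    have E: "((\<lambda>s. r s - \<rho>) has_real_derivative
        (r s - \<rho>) * - (r s * (w s)\<^sup>2 * (r s - (b - \<rho>)))) (at s)" for s
    proof -
      have D: "((\<lambda>s. r s - \<rho>) has_real_derivative r s * ((w s)\<^sup>2 * (c + 1 + b * r s - (r s)\<^sup>2))) (at s)"
        by (rule derivative_eq_intros r_der refl | simp)+
      \<comment> \<open>By Vieta the other root is \<open>b - \<rho>\<close>; the factorization
        turns the equation into a linear one for \<open>r - \<rho>\<close>.\<close>
      have fac: "c + 1 + b * r s - (r s)\<^sup>2 = - ((r s - \<rho>) * (r s - (b - \<rho>)))"
      proof -
        have "c = \<rho>\<^sup>2 - b * \<rho> - 1" using \<rho> by simp
        then show ?thesis by (simp add: algebra_simps power2_eq_square)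
      qed
      have "r s * ((w s)\<^sup>2 * - ((r s - \<rho>) * (r s - (b - \<rho>)))) =
          (r s - \<rho>) * - (r s * (w s)\<^sup>2 * (r s - (b - \<rho>)))" by simp
      then show ?thesis using D unfolding fac by (simp only:)
    qed
    have "r s - \<rho> = 0" for s
      using linear_ode_zero[OF C E, of t s] hit by simp
    then have "r = (\<lambda>_. \<rho>)" by (auto simp: fun_eq_iff)
    then have "\<rho> = 0" using r_top by (simp add: tendsto_const_iff)
    then show False using hit r_nz by auto
  qed
  obtain j s where j: "s \<in> {1, - 1}" "p = s *\<^sub>R axis j 1"
    using p unfolding poles_iff by blast
  have bot: "((\<lambda>t. x t $ l) \<longlongrightarrow> (if l = j then s else 0)) at_bot" for l
    using tendsto_vec_nth[OF x_bot, of l] j by (simp add: axis_def split: if_splits)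
  have "j = i \<or> j = i + 1"
  proof (rule ccontr)
    assume "\<not> ?thesis"
    then have "(\<lambda>t. x t $ j) = (\<lambda>_. 0)" using off by auto
    then show False using bot[of j] j(1) by (auto simp: tendsto_const_iff)
  qed
  \<comment> \<open>With source and target on the same axis, \<open>r\<close> would tend to 0 at
    both ends; at a critical point of \<open>r\<close> the quadratic vanishes, so \<open>r\<close>
    would attain a root.\<close>
  moreover have "j \<noteq> i"
  proof
    assume "j = i"
    then have "(r \<longlongrightarrow> 0 / s) at_bot"
      unfolding r_def w_def v_def using bot[of i] bot[of "i + 1"] j(1) idx
      by (intro tendsto_divide) auto
    then obtain t where "r t * ((w t)\<^sup>2 * (c + 1 + b * r t - (r t)\<^sup>2)) = 0"
      using vanishing_at_both_ends_imp_critical_point[OF r_der _ r_top r_nz] by auto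
    then show False using r_nz[of t] w_nz[of t] no_root[of "r t" t] by auto
  qed
  ultimately have ji: "j = i + 1" by simp
  \<comment> \<open>The ratio is unbounded near the source, so the intermediate value theorem is
    applied to a linear form in \<open>v\<close> and \<open>w\<close>, with limits 1 at the source
    and \<open>- r0\<close> at the target.\<close>
  have root_free: "c + 1 + b * (s * \<tau> * r0) - r0\<^sup>2 \<noteq> 0" if r0: "r0 > 0" for r0
  proof
    assume root: "c + 1 + b * (s * \<tau> * r0) - r0\<^sup>2 = 0"
    txt \<open>\<open>\<phi>\<close> vanishes where \<open>r = s\<tau>r\<^sub>0\<close>.\<close>
    define \<phi> where "\<phi> = (\<lambda>t. s * v t - r0 * (\<tau> * w t))"
    have "(\<phi> \<longlongrightarrow> s * 0 - r0 * (\<tau> * \<tau>)) at_top"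
      unfolding \<phi>_def w_def v_def using top[of i] top[of "i + 1"] idx by (intro tendsto_intros) auto
    then have "eventually (\<lambda>t. \<phi> t < 0) at_top"
      by (rule order_tendstoD) (use sg r0 in auto)
    then obtain t1 where t1: "\<And>t. t \<ge> t1 \<Longrightarrow> \<phi> t < 0"
      by (auto simp: eventually_at_top_linorder)
    have "(\<phi> \<longlongrightarrow> s * s - r0 * (\<tau> * 0)) at_bot"
      unfolding \<phi>_def w_def v_def using bot[of i] bot[of "i + 1"] idx ji by (intro tendsto_intros) auto
    then have "eventually (\<lambda>t. \<phi> t > 0) at_bot"
      by (rule order_tendstoD) (use j(1) in auto)
    then obtain t0 where t0: "\<And>t. t \<le> t0 \<Longrightarrow> \<phi> t > 0"
      by (auto simp: eventually_at_bot_linorder)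
    have "isCont \<phi> t" for t
      unfolding \<phi>_def by (intro continuous_intros w_cont v_cont)
    then obtain t where "\<phi> t = 0"
      using IVT2[of \<phi> "max t0 t1" 0 "min t0 t1"] t0[of "min t0 t1"] t1[of "max t0 t1"] by fastforce
    then have "r t = s * \<tau> * r0"
      using w_nz[of t] sg j(1) by (auto simp: \<phi>_def r_def field_simps)
    moreover have "(s * \<tau> * r0)\<^sup>2 = r0\<^sup>2" using sg j(1) by auto
    ultimately show False using no_root[of "s * \<tau> * r0" t] root by simp
  qed
  show ?thesis
  proof (intro bexI conjI allI impI)
    show "s * \<tau> \<in> {1, - 1}" "p = (s * \<tau> * \<tau>) *\<^sub>R axis (i + 1) 1"
      using sg j ji by auto
    show "c + 1 + b * (s * \<tau> * r) - r\<^sup>2 \<noteq> 0" if "r > 0" for r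
      using root_free[OF that] .
  qed
qed

section \<open>Transfer along topological equivalences\<close>

text \<open>As the time change is surjective, the constant orbit at \<open>p\<close> has a constant
  image, whose derivative is both 0 and \<open>f (h p)\<close>.\<close>

lemma maps_orbits_equilibrium:
  assumes "maps_orbits g N f M h" and p: "equilibrium g N p"
  shows "equilibrium f M (h p)"
proof -
  have "trajectory g N (\<lambda>_. p)" using p by (simp add: equilibrium_def trajectory_def)
  then obtain y and \<tau> :: "real \<Rightarrow> real" where y: "trajectory f M y" "surj \<tau>" "\<And>t. h p = y (\<tau> t)"
    using assms(1) unfolding maps_orbits_def by blast
  have "y = (\<lambda>_. h p)" using y(2,3) by (metis surj_def ext)
  then have "h p \<in> M" and "((\<lambda>_. h p) has_vector_derivative f (h p)) (at 0)"
    using y(1) by (auto simp: trajectory_def)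
  then show ?thesis
    using vector_derivative_unique_at[OF _ has_vector_derivative_const]
    unfolding equilibrium_def by blast
qed

text \<open>The image orbit is \<open>h \<circ> x \<circ> \<sigma>\<close> for the inverse
  \<open>\<sigma>\<close> of the time change. Monotonicity preserves both ends of time, and
  injectivity of \<open>h\<close> keeps the orbit nonconstant.\<close>

lemma maps_orbits_connection:
  assumes homeo: "homeomorphism N M h h'" and orb: "maps_orbits g N f M h"
    and con: "heteroclinic_connection g N p q x"
  obtains y where "heteroclinic_connection f M (h p) (h q) y"
proof -
  have x: "trajectory g N x" "\<And>t. x t \<in> N" "\<not> x constant_on UNIV"
    "(x \<longlongrightarrow> p) at_bot" "(x \<longlongrightarrow> q) at_top" and pq: "equilibrium g N p" "equilibrium g N q"
    using con by (auto simp: heteroclinic_connection_def trajectory_def)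
  obtain y and \<tau> :: "real \<Rightarrow> real" where y: "trajectory f M y" "strict_mono \<tau>" "surj \<tau>"
    "\<And>t. h (x t) = y (\<tau> t)"
    using orb x(1) unfolding maps_orbits_def by blast
  obtain \<sigma> where \<sigma>: "\<And>t. \<tau> (\<sigma> t) = t" using y(3) by (metis surj_def)
  have ge: "z \<le> \<sigma> t \<longleftrightarrow> \<tau> z \<le> t" and le: "\<sigma> t \<le> z \<longleftrightarrow> t \<le> \<tau> z" for z t
    using \<sigma>[of t] strict_mono_less_eq[OF y(2), of z "\<sigma> t"] strict_mono_less_eq[OF y(2), of "\<sigma> t" z]
    by auto
  have \<sigma>_lim: "filterlim \<sigma> at_top at_top" "filterlim \<sigma> at_bot at_bot"
    unfolding filterlim_at_top filterlim_at_bot eventually_at_top_linorder eventually_at_bot_linorder ge le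
    by auto
  have y_eq: "y = (\<lambda>t. h (x (\<sigma> t)))" using y(4) \<sigma> by (metis ext)
  have h: "continuous_on N h" "inj_on h N"
    using homeo by (auto simp: homeomorphism_def inj_on_def) metis
  have "(y \<longlongrightarrow> h l) F" if "(x \<longlongrightarrow> l) F'" "l \<in> N" "filterlim \<sigma> F' F" for l F F'
    unfolding y_eq
    by (rule continuous_on_tendsto_compose[OF h(1) filterlim_compose[OF that(1,3)] that(2)])
      (simp add: x(2))
  then have "(y \<longlongrightarrow> h p) at_bot" "(y \<longlongrightarrow> h q) at_top"
    using x(4,5) \<sigma>_lim pq unfolding equilibrium_def by blast+
  moreover have "\<not> y constant_on UNIV"
  proof
    assume "y constant_on UNIV"
    then have "h (x t) = h (x s)" for s t by (auto simp: constant_on_def y(4))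
    then have "x t = x 0" for t using h(2) x(2) by (meson inj_onD)
    then show False using x(3) by (auto simp: constant_on_def)
  qed
  ultimately show thesis
    using that[of y] y(1) maps_orbits_equilibrium[OF orb] pq
    unfolding heteroclinic_connection_def by blast
qed

lemma topological_equivalence_connection:
  assumes "topological_equivalence g N f M h" and "p \<in> N" "q \<in> N"
  shows "(\<exists>y. heteroclinic_connection f M (h p) (h q) y) \<longleftrightarrow>
    (\<exists>x. heteroclinic_connection g N p q x)"
proof -
  obtain h' where h': "homeomorphism N M h h'" "maps_orbits g N f M h" "maps_orbits f M g N h'"
    using assms(1) by (auto simp: topological_equivalence_def)
  have "h' (h p) = p" "h' (h q) = q"
    using h'(1) assms(2,3) by (auto simp: homeomorphism_def)
  then show ?thesis
    using maps_orbits_connection[OF h'(1,2)]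
      maps_orbits_connection[OF homeomorphism_symD[OF h'(1)] h'(3)] by metis
qed

text \<open>Makes the flow on the unit sphere the case \<open>\<psi> = id\<close> of a transferred
  flow, so that one argument covers both readings of the theorem.\<close>

lemma topological_equivalence_id: "topological_equivalence f M f M id"
proof -
  have "\<exists>y \<tau>. trajectory f M y \<and> strict_mono (\<tau> :: real \<Rightarrow> real) \<and> surj \<tau> \<and> (\<forall>t. id (x t) = y (\<tau> t))"
    if "trajectory f M x" for x
    using that by (intro exI[of _ x] exI[of _ "\<lambda>t. t"]) (auto simp: strict_mono_def)
  moreover have "homeomorphism M M id id" by (auto simp: homeomorphism_def)
  ultimately show ?thesis unfolding topological_equivalence_def maps_orbits_def by blast
qed

section \<open>Cycles and networks of poles\<close>

lemma inj_on_of_nat_mod_ring: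
  "inj_on (of_nat :: nat \<Rightarrow> 'n::nontriv mod_ring) {1..CARD('n)}"
proof (rule inj_onI)
  fix a c assume "a \<in> {1..CARD('n)}" "c \<in> {1..CARD('n)}"
    and "(of_nat a :: 'n mod_ring) = of_nat c"
  then show "a = c"
    unfolding of_nat_mod_ring_eq_iff
    by (cases "a = CARD('n)"; cases "c = CARD('n)") auto
qed

lemma image_of_nat_mod_ring:
  "(of_nat :: nat \<Rightarrow> 'n::nontriv mod_ring) ` {1..CARD('n)} = UNIV"
proof -
  have "i \<in> of_nat ` {1..CARD('n)}" for i :: "'n mod_ring"
  proof -
    obtain k where k: "k < CARD('n)" "i = of_nat k" by (rule mod_ring_eq_of_nat)
    show ?thesis
    proof (cases "k = 0")
      case True
      then have "i = of_nat CARD('n)" using k by simp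
      then show ?thesis by (intro image_eqI[where x = "CARD('n)"]) (auto simp: Suc_leI)
    qed (use k in auto)
  qed
  then show ?thesis by auto
qed

text \<open>The cycles of the network are all the choices of one sign per axis; two opposite choices
  are linked through a choice that mixes them.\<close>

lemma sign_choice_network:
  fixes V :: "bool \<Rightarrow> 'n::nontriv mod_ring \<Rightarrow> 'v::euclidean_space"
  assumes inj: "\<And>s s' i j. V s i = V s' j \<longleftrightarrow> s = s' \<and> i = j"
    and conn: "\<And>i s s'. \<exists>x. heteroclinic_connection f M (V s (i + 1)) (V s' i) x"
  shows "\<exists>\<C>. heteroclinic_network f M \<C> \<and>
    network_equilibria \<C> = (\<Union>i. {V True i, V False i}) \<and>
    (\<forall>i s s'. \<exists>x. (V s (i + 1), x, V s' i) \<in> network_connections \<C>)"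
proof -
  define n where "n = CARD('n)"
  have n: "n \<ge> 1" using nontriv[where 'a = 'n] by (simp add: n_def)
  have n0: "(of_nat n :: 'n mod_ring) = 0" by (simp add: n_def)
  \<comment> \<open>One connection is fixed for each pair of points, so a cycle is determined by its
    sign choice.\<close>
  define X where "X = (\<lambda>p q. SOME x. heteroclinic_connection f M p q x)"
  have X: "heteroclinic_connection f M (V s (i + 1)) (V s' i) (X (V s (i + 1)) (V s' i))" for s s' i
    unfolding X_def using conn by (rule someI_ex)
  define F where "F = (\<lambda>(\<epsilon> :: 'n mod_ring \<Rightarrow> bool) k. V (\<epsilon> (of_nat k)) (of_nat k))"
  define P where "P = (\<lambda>\<epsilon>. map (F \<epsilon>) (rev [1..<n+1]))"
  define C where "C = (\<lambda>\<epsilon>. (P \<epsilon>, map (\<lambda>k. X (P \<epsilon> ! k) (P \<epsilon> ! (Suc k mod n))) [0..<n]))"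
  have len: "length (P \<epsilon>) = n" for \<epsilon> by (simp add: P_def)
  have set_P: "set (P \<epsilon>) = range (\<lambda>i. V (\<epsilon> i) i)" for \<epsilon>
  proof -
    have "F \<epsilon> ` {1..n} = (\<lambda>i. V (\<epsilon> i) i) ` (of_nat ` {1..n})"
      by (simp add: F_def image_image)
    then show ?thesis
      unfolding P_def set_map_rev_upt n_def image_of_nat_mod_ring .
  qed
  have "rel_cycle (\<lambda>p q. heteroclinic_connection f M p q (X p q)) (P \<epsilon>)" for \<epsilon>
    unfolding P_def
  proof (rule rel_cycle_rev_upt[OF n])
    show "inj_on (F \<epsilon>) {1..n}"
    proof (rule inj_onI)
      fix k l assume "k \<in> {1..n}" "l \<in> {1..n}" "F \<epsilon> k = F \<epsilon> l"
      then show "k = l"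
        using inj_on_of_nat_mod_ring[where 'n = 'n] unfolding F_def inj n_def by (blast dest: inj_onD)
    qed
    show "heteroclinic_connection f M (F \<epsilon> (Suc i)) (F \<epsilon> i) (X (F \<epsilon> (Suc i)) (F \<epsilon> i))" for i
      using X[of _ "of_nat i"] by (simp add: F_def add.commute)
    show "heteroclinic_connection f M (F \<epsilon> 1) (F \<epsilon> n) (X (F \<epsilon> 1) (F \<epsilon> n))"
      using X[of _ 0] by (simp add: F_def n0)
  qed
  then have cyc: "heteroclinic_cycle f M (C \<epsilon>)" for \<epsilon>
    by (auto simp: rel_cycle_def heteroclinic_cycle_def C_def len)
  have fst_C: "set (fst (C \<epsilon>)) = range (\<lambda>i. V (\<epsilon> i) i)" for \<epsilon>
    by (simp add: C_def set_P)
  have "C (\<lambda>_. True) \<noteq> C (\<lambda>_. False)"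
  proof
    assume "C (\<lambda>_. True) = C (\<lambda>_. False)"
    then have "V True 0 \<in> range (\<lambda>i. V False i)"
      using fst_C[of "\<lambda>_. True"] fst_C[of "\<lambda>_. False"] by auto
    then show False by (auto simp: inj)
  qed
  then have "card {C (\<lambda>_. True), C (\<lambda>_. False)} = 2" by simp
  moreover have fin: "finite (range C)" by simp
  ultimately have card: "card (range C) \<ge> 2"
    by (metis card_mono insert_subset empty_subsetI rangeI)
  let ?S = "{(A, B). A \<in> range C \<and> B \<in> range C \<and> set (fst A) \<inter> set (fst B) \<noteq> {}}"
  have "(C \<epsilon>, C \<delta>) \<in> ?S\<^sup>*" for \<epsilon> \<delta>
  proof -
    \<comment> \<open>\<open>\<mu>\<close> takes its sign at axis 0 from \<open>\<delta>\<close> and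
      all others, in particular that at axis 1, from \<open>\<epsilon>\<close>, so its cycle meets
      both.\<close>
    define \<mu> where "\<mu> = \<epsilon>(0 := \<delta> 0)"
    have "V (\<epsilon> 1) 1 \<in> set (fst (C \<epsilon>)) \<inter> set (fst (C \<mu>))"
      unfolding fst_C \<mu>_def by (auto simp: image_iff inj)
    moreover have "V (\<delta> 0) 0 \<in> set (fst (C \<mu>)) \<inter> set (fst (C \<delta>))"
      unfolding fst_C \<mu>_def by (auto simp: image_iff inj)
    ultimately have "(C \<epsilon>, C \<mu>) \<in> ?S" "(C \<mu>, C \<delta>) \<in> ?S" by blast+
    then show ?thesis by (meson converse_rtrancl_into_rtrancl r_into_rtrancl)
  qed
  then have "heteroclinic_network f M (range C)"
    using fin card cyc by (auto simp: heteroclinic_network_def)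
  moreover have "network_equilibria (range C) = (\<Union>i. {V True i, V False i})"
  proof -
    have eq: "network_equilibria (range C) = (\<Union>\<epsilon>. range (\<lambda>i. V (\<epsilon> i) i))"
      by (simp add: network_equilibria_def fst_C)
    have "V s i \<in> {V True i, V False i}" for s i by (cases s) auto
    moreover have "V s i \<in> network_equilibria (range C)" for s i
      unfolding eq by (rule UN_I[of "\<lambda>_. s"]) auto
    ultimately show ?thesis unfolding eq by blast
  qed
  moreover have "\<exists>x. (V s (i + 1), x, V s' i) \<in> network_connections (range C)" for i s s'
  proof -
    \<comment> \<open>A sign choice whose cycle contains the prescribed step: \<open>s'\<close> at
      \<open>i\<close>, and \<open>s\<close> at \<open>i + 1\<close>, which differs from
      \<open>i\<close>.\<close>
    define \<epsilon> where "\<epsilon> = (\<lambda>j. if j = i then s' else s)"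
    obtain k where k: "k < n" "i = of_nat k" unfolding n_def by (rule mod_ring_eq_of_nat)
    \<comment> \<open>The position of index \<open>k + 1\<close> in the descending list. For
      \<open>k = 0\<close> the next position wraps around to the head, where index \<open>n\<close>
      stands for 0.\<close>
    define m where "m = n - Suc k"
    have m: "m < n" "n - m = Suc k" using k by (auto simp: m_def)
    have "P \<epsilon> ! m = F \<epsilon> (Suc k)"
      unfolding P_def nth_map_rev_upt[OF m(1)] m(2) ..
    then have 1: "P \<epsilon> ! m = V s (i + 1)"
      by (simp add: F_def \<epsilon>_def k(2) add.commute)
    have "P \<epsilon> ! (Suc m mod n) = V s' i"
    proof (cases "k = 0")
      case True
      then have "Suc m mod n = 0" using m by (simp add: m_def)
      then have "P \<epsilon> ! (Suc m mod n) = F \<epsilon> n"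
        unfolding P_def using nth_map_rev_upt[of 0 n "F \<epsilon>"] n by simp
      then show ?thesis using True k n0 by (simp add: F_def \<epsilon>_def)
    next
      case False
      then have "Suc m < n" "n - Suc m = k" using k by (auto simp: m_def)
      then have "P \<epsilon> ! (Suc m mod n) = F \<epsilon> k"
        unfolding P_def using nth_map_rev_upt[of "Suc m" n "F \<epsilon>"] by simp
      then show ?thesis using k by (simp add: F_def \<epsilon>_def)
    qed
    then have "(V s (i + 1), X (V s (i + 1)) (V s' i), V s' i) \<in> cycle_connections (C \<epsilon>)"
      using 1 m(1) by (auto simp: cycle_connections_def C_def len intro!: exI[of _ m])
    then show ?thesis unfolding network_connections_def by blast
  qed
  ultimately show ?thesis by blast
qed

text \<open>Here \<open>n\<close> may be a larger multiple of the number of axes: a list can pass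
  through them twice if the signs tell the two visits apart.\<close>

lemma sign_cycle:
  fixes \<psi> :: "real ^ 'n::nontriv mod_ring \<Rightarrow> 'v"
  assumes inj: "inj_on \<psi> poles" and n: "n \<ge> 1" "(of_nat n :: 'n mod_ring) = 0"
    and R: "\<And>i \<tau>. \<tau> \<in> {1, - 1} \<Longrightarrow> R (\<psi> ((\<sigma> * \<tau>) *\<^sub>R axis (i + 1) 1)) (\<psi> (\<tau> *\<^sub>R axis i 1))"
    and \<epsilon>: "\<And>i. \<epsilon> i \<in> {1, - 1}" "\<And>i. 1 \<le> i \<Longrightarrow> i < n \<Longrightarrow> \<epsilon> (Suc i) = \<sigma> * \<epsilon> i" "\<epsilon> 1 = \<sigma> * \<epsilon> n"
    and distinct: "\<And>i j. i \<in> {1..n} \<Longrightarrow> j \<in> {1..n} \<Longrightarrow> (of_nat i :: 'n mod_ring) = of_nat j \<Longrightarrow>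
      \<epsilon> i = \<epsilon> j \<Longrightarrow> i = j"
  shows "rel_cycle R (map (\<lambda>i. \<psi> (\<epsilon> i *\<^sub>R axis (of_nat i) 1)) (rev [1..<n+1]))"
proof (rule rel_cycle_rev_upt[OF n(1)])
  have pole: "\<epsilon> i *\<^sub>R axis (of_nat i :: 'n mod_ring) 1 \<in> poles" for i
    using \<epsilon>(1)[of i] unfolding poles_iff by blast
  show "inj_on (\<lambda>i. \<psi> (\<epsilon> i *\<^sub>R axis (of_nat i) 1)) {1..n}"
  proof (rule inj_onI)
    fix i j assume ij: "i \<in> {1..n}" "j \<in> {1..n}"
      and "\<psi> (\<epsilon> i *\<^sub>R axis (of_nat i) 1) = \<psi> (\<epsilon> j *\<^sub>R axis (of_nat j) 1)"
    then have "\<epsilon> i *\<^sub>R axis (of_nat i :: 'n mod_ring) (1::real) = \<epsilon> j *\<^sub>R axis (of_nat j) 1"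
      using inj_onD[OF inj _ pole pole] by blast
    moreover have "\<epsilon> i \<noteq> 0" using \<epsilon>(1)[of i] by auto
    ultimately show "i = j" using distinct[OF ij] by (simp add: scaleR_axis_eq_iff)
  qed
  show "R (\<psi> (\<epsilon> (Suc i) *\<^sub>R axis (of_nat (Suc i)) 1)) (\<psi> (\<epsilon> i *\<^sub>R axis (of_nat i) 1))"
    if "1 \<le> i" "i < n" for i
    using R[OF \<epsilon>(1)[of i], of "of_nat i"] \<epsilon>(2)[OF that] by (simp add: add.commute)
  show "R (\<psi> (\<epsilon> 1 *\<^sub>R axis (of_nat 1) 1)) (\<psi> (\<epsilon> n *\<^sub>R axis (of_nat n) 1))"
    using R[OF \<epsilon>(1)[of n], of 0] \<epsilon>(3) n(2) by simp
qed

lemma pole_of_nat: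
  assumes "p \<in> (poles :: (real ^ 'n::nontriv mod_ring) set)"
  obtains s k where "s \<in> {1, - 1}" "k \<in> {1..CARD('n)}" "p = s *\<^sub>R axis (of_nat k) 1"
proof -
  obtain i s where "s \<in> {1, - 1}" "p = s *\<^sub>R axis i 1"
    using assms unfolding poles_iff by blast
  moreover obtain k where "k \<in> {1..CARD('n)}" "i = of_nat k"
    using image_of_nat_mod_ring[where 'n = 'n] by blast
  ultimately show thesis using that by blast
qed

text \<open>Flipping all signs of one cycle gives the other. Together they contain both signs of
  every axis, hence all poles, and unique predecessors leave room for no further cycle.\<close>

lemma two_sign_cycles:
  fixes \<psi> :: "real ^ 'n::nontriv mod_ring \<Rightarrow> 'v"
  assumes inj: "inj_on \<psi> poles" and n: "n = CARD('n)"
    and R: "\<And>i \<tau>. \<tau> \<in> {1, - 1} \<Longrightarrow> R (\<psi> ((\<sigma> * \<tau>) *\<^sub>R axis (i + 1) 1)) (\<psi> (\<tau> *\<^sub>R axis i 1))"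
    and det: "\<And>p p' q. R p q \<Longrightarrow> R p' q \<Longrightarrow> p = p'" and dom: "\<And>p q. R p q \<Longrightarrow> p \<in> \<psi> ` poles"
    and \<epsilon>: "\<And>i. \<epsilon> i \<in> {1, - 1}" "\<And>i. 1 \<le> i \<Longrightarrow> i < n \<Longrightarrow> \<epsilon> (Suc i) = \<sigma> * \<epsilon> i" "\<epsilon> 1 = \<sigma> * \<epsilon> n"
  defines "A \<equiv> cyclic_list (map (\<lambda>i. \<psi> (\<epsilon> i *\<^sub>R axis (of_nat i) 1)) (rev [1..<n+1]))"
    and "B \<equiv> cyclic_list (map (\<lambda>i. \<psi> (- (\<epsilon> i *\<^sub>R axis (of_nat i) 1))) (rev [1..<n+1]))"
  shows "A \<noteq> B \<and> cyclic_list ` {ps. rel_cycle R ps} = {A, B}"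
proof -
  let ?A = "\<lambda>i. \<psi> (\<epsilon> i *\<^sub>R axis (of_nat i) 1)" and ?B = "\<lambda>i. \<psi> (- (\<epsilon> i *\<^sub>R axis (of_nat i) 1))"
  have n': "n \<ge> 1" "(of_nat n :: 'n mod_ring) = 0"
    using nontriv[where 'a = 'n] by (auto simp: n)
  have distinct: "i = j" if "i \<in> {1..n}" "j \<in> {1..n}" "(of_nat i :: 'n mod_ring) = of_nat j" for i j
    using inj_on_of_nat_mod_ring[where 'n = 'n] that unfolding n by (blast dest: inj_onD)
  have A: "rel_cycle R (map ?A (rev [1..<n+1]))"
    by (rule sign_cycle[where \<psi> = \<psi> and R = R and \<sigma> = \<sigma> and \<epsilon> = \<epsilon>, OF inj n' R \<epsilon>])
      (assumption | rule distinct)+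
  have "rel_cycle R (map (\<lambda>i. \<psi> ((- \<epsilon> i) *\<^sub>R axis (of_nat i) 1)) (rev [1..<n+1]))"
  proof (rule sign_cycle[where \<psi> = \<psi> and R = R and \<sigma> = \<sigma> and \<epsilon> = "\<lambda>i. - \<epsilon> i", OF inj n' R])
    show "- \<epsilon> i \<in> {1, - 1}" for i using \<epsilon>(1)[of i] by auto
    show "- \<epsilon> (Suc i) = \<sigma> * - \<epsilon> i" if "1 \<le> i" "i < n" for i using \<epsilon>(2)[OF that] by simp
    show "- \<epsilon> 1 = \<sigma> * - \<epsilon> n" using \<epsilon>(3) by simp
  qed (assumption | rule distinct)+
  then have B: "rel_cycle R (map ?B (rev [1..<n+1]))" unfolding scaleR_minus_left .
  have cover: "p \<in> set (map ?A (rev [1..<n+1])) \<union> set (map ?B (rev [1..<n+1]))" if "R p q" for p q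
  proof -
    obtain p0 where p0: "p = \<psi> p0" "p0 \<in> poles" using dom[OF \<open>R p q\<close>] by blast
    from p0(2) obtain s k where sk: "s \<in> {1, - 1}" "k \<in> {1..n}" "p0 = s *\<^sub>R axis (of_nat k) 1"
      unfolding n by (rule pole_of_nat)
    have "s = \<epsilon> k \<or> s = - \<epsilon> k" using sk(1) \<epsilon>(1)[of k] by auto
    then have "p = ?A k \<or> p = ?B k" using p0(1) sk(3) by auto
    then show ?thesis unfolding set_map_rev_upt using sk(2) by blast
  qed
  \<comment> \<open>Rotations preserve the set of entries, and at each axis the two lists carry
    opposite signs.\<close>
  have "A \<noteq> B"
  proof
    assume "A = B"
    then have "set (map ?A (rev [1..<n+1])) = set (map ?B (rev [1..<n+1]))"
      unfolding A_def B_def by (rule cyclic_list_eq_imp_set_eq)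
    then have "?A n \<in> ?B ` {1..n}" unfolding set_map_rev_upt using n'(1) by auto
    then obtain k where k: "k \<in> {1..n}" "?A n = ?B k" by blast
    have "- \<epsilon> k \<in> {1, - 1}" using \<epsilon>(1)[of k] by auto
    then have pole: "\<epsilon> n *\<^sub>R axis (of_nat n :: 'n mod_ring) 1 \<in> poles"
      "(- \<epsilon> k) *\<^sub>R axis (of_nat k :: 'n mod_ring) 1 \<in> poles"
      using \<epsilon>(1)[of n] unfolding poles_iff by blast+
    have "\<psi> (\<epsilon> n *\<^sub>R axis (of_nat n) 1) = \<psi> ((- \<epsilon> k) *\<^sub>R axis (of_nat k) 1)"
      using k(2) by simp
    from inj_onD[OF inj this pole]
    have "(of_nat n :: 'n mod_ring) = of_nat k" "\<epsilon> n = - \<epsilon> k"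
      using scaleR_axis_eq_iff[of "\<epsilon> n" "of_nat n :: 'n mod_ring" "- \<epsilon> k" "of_nat k"] \<epsilon>(1)[of n]
      by auto
    then show False using distinct[of n k] k(1) n'(1) \<epsilon>(1)[of n] by auto
  qed
  moreover have "cyclic_list ` {ps. rel_cycle R ps} = {A, B}"
    unfolding A_def B_def by (rule rel_cycle_classes[OF det A B cover])
  ultimately show ?thesis ..
qed

lemma rev_upt_double: "rev [1..<2*n+1] = map (\<lambda>i. i + n) (rev [1..<n+1]) @ rev [1..<n+1]"
proof -
  have "[1..<2*n+1] = [1..<n+1] @ [n+1..<(n+1)+n]"
    using upt_add_eq_append[of 1 "n+1" n] by (simp add: mult_2 del: upt_Suc)
  also have "[n+1..<(n+1)+n] = map (\<lambda>i. i + n) [1..<n+1]"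
    by (rule nth_equalityI) (simp_all del: upt_Suc)
  finally show ?thesis by (simp add: rev_map del: upt_Suc)
qed

text \<open>The signs alternate along the cycle, so for odd \<open>n\<close> it closes only after running twice
  through the axes; \<open>\<epsilon>\<close> below is indexed by \<open>1, \<dots>, 2n\<close>.\<close>

lemma one_alternating_cycle:
  fixes \<psi> :: "real ^ 'n::nontriv mod_ring \<Rightarrow> 'v"
  assumes inj: "inj_on \<psi> poles" and n: "n = CARD('n)" and odd: "odd n"
    and R: "\<And>i \<tau>. \<tau> \<in> {1, - 1} \<Longrightarrow> R (\<psi> ((- 1 * \<tau>) *\<^sub>R axis (i + 1) 1)) (\<psi> (\<tau> *\<^sub>R axis i 1))"
    and det: "\<And>p p' q. R p q \<Longrightarrow> R p' q \<Longrightarrow> p = p'" and dom: "\<And>p q. R p q \<Longrightarrow> p \<in> \<psi> ` poles"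
  shows "cyclic_list ` {ps. rel_cycle R ps} =
    {cyclic_list (map (\<lambda>i. \<psi> ((- 1) ^ (n - i) *\<^sub>R axis (of_nat i) 1)) (rev [1..<n+1]) @
      map (\<lambda>i. \<psi> (- ((- 1) ^ (n - i) *\<^sub>R axis (of_nat i) 1))) (rev [1..<n+1]))}"
proof -
  \<comment> \<open>The exponent gives the sign 1 at \<open>2 * n\<close>, the head of the list. As
    \<open>n\<close> is odd, the two visits \<open>i\<close> and \<open>i + n\<close> to one axis
    receive opposite signs.\<close>
  define \<epsilon> :: "nat \<Rightarrow> real" where "\<epsilon> = (\<lambda>i. (- 1) ^ (2 * n - i))"
  define E where "E = (\<lambda>i. \<psi> (\<epsilon> i *\<^sub>R axis (of_nat i) 1))"
  define L where "L = map E (rev [1..<2*n+1])"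
  have n0: "(of_nat n :: 'n mod_ring) = 0" by (simp add: n)
  have n1: "n \<ge> 1" using nontriv[where 'a = 'n] by (simp add: n)
  have \<epsilon>: "\<epsilon> i \<in> {1, - 1}" for i
    unfolding \<epsilon>_def by (cases "even (2 * n - i)") auto
  have shift: "\<epsilon> (i + n) = (- 1) ^ (n - i)" for i
    by (simp add: \<epsilon>_def)
  have first: "\<epsilon> i = - ((- 1) ^ (n - i))" if "i \<le> n" for i
  proof -
    have "2 * n - i = n + (n - i)" using that by simp
    then show ?thesis using odd by (simp add: \<epsilon>_def power_add)
  qed
  have L: "L = map (\<lambda>i. \<psi> ((- 1) ^ (n - i) *\<^sub>R axis (of_nat i) 1)) (rev [1..<n+1]) @
      map (\<lambda>i. \<psi> (- ((- 1) ^ (n - i) *\<^sub>R axis (of_nat i) 1))) (rev [1..<n+1])"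
    unfolding L_def rev_upt_double map_append map_map
  proof (intro arg_cong2[where f = append] map_cong refl)
    show "(E \<circ> (\<lambda>i. i + n)) i = \<psi> ((- 1) ^ (n - i) *\<^sub>R axis (of_nat i) 1)" for i
      by (simp add: E_def shift n0)
    show "E i = \<psi> (- ((- 1) ^ (n - i) *\<^sub>R axis (of_nat i) 1))" if "i \<in> set (rev [1..<n+1])" for i
      using that first[of i] by (simp add: E_def del: upt_Suc)
  qed
  have step: "\<epsilon> (Suc i) = - 1 * \<epsilon> i" if "i < 2 * n" for i
  proof -
    have "2 * n - i = Suc (2 * n - Suc i)" using that by simp
    then show ?thesis by (simp add: \<epsilon>_def)
  qed
  have cyc: "rel_cycle R L"
    unfolding L_def E_def
  proof (rule sign_cycle[where \<psi> = \<psi> and R = R and \<sigma> = "- 1" and \<epsilon> = \<epsilon>, OF inj _ _ R \<epsilon> step])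
    show "1 \<le> 2 * n" using n1 by simp
    show "(of_nat (2 * n) :: 'n mod_ring) = 0" by (simp add: n0)
    show "\<epsilon> 1 = - 1 * \<epsilon> (2 * n)" using step[of 0] n1 by (simp add: \<epsilon>_def)
    fix i j assume ij: "i \<in> {1..2 * n}" "j \<in> {1..2 * n}" "(of_nat i :: 'n mod_ring) = of_nat j" "\<epsilon> i = \<epsilon> j"
    have reduce: "\<exists>k\<in>{1..n}. i = k \<or> i = k + n" if "i \<in> {1..2 * n}" for i
    proof (cases "i \<le> n")
      case False
      then show ?thesis using that by (intro bexI[of _ "i - n"]) auto
    qed (use that in auto)
    obtain k l where kl: "k \<in> {1..n}" "l \<in> {1..n}" "i = k \<or> i = k + n" "j = l \<or> j = l + n"
      using reduce ij(1,2) by metis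
    then have "(of_nat k :: 'n mod_ring) = of_nat l" using ij(3) n0 by auto
    then have "k = l"
      using inj_on_of_nat_mod_ring[where 'n = 'n] kl(1,2) unfolding n by (blast dest: inj_onD)
    moreover have "\<epsilon> k \<noteq> \<epsilon> (k + n)" using kl(1) shift[of k] first[of k] by auto
    ultimately show "i = j" using kl ij(4) by auto
  qed
  have cover: "p \<in> set L \<union> set L" if "R p q" for p q
  proof -
    obtain p0 where p0: "p = \<psi> p0" "p0 \<in> poles" using dom[OF \<open>R p q\<close>] by blast
    from p0(2) obtain s k where sk: "s \<in> {1, - 1}" "k \<in> {1..n}" "p0 = s *\<^sub>R axis (of_nat k) 1"
      unfolding n by (rule pole_of_nat)
    have "\<epsilon> k = - \<epsilon> (k + n)" using sk(2) shift[of k] first[of k] by auto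
    then have "s = \<epsilon> k \<or> s = \<epsilon> (k + n)" using sk(1) \<epsilon>[of k] by auto
    then have "p = E k \<or> p = E (k + n)" using p0(1) sk(3) n0 by (auto simp: E_def)
    then show ?thesis unfolding L_def set_map_rev_upt using sk(2) by auto
  qed
  show ?thesis
    using rel_cycle_classes[OF det cyc cyc cover] unfolding L[symmetric] by simp
qed

section \<open>The two coefficient regimes\<close>

theorem proposition2:
  fixes lam b c :: real
    and n :: nat
    and Q f \<psi> :: "real ^ 'n::nontriv mod_ring \<Rightarrow> real ^ 'n mod_ring"
    and M :: "(real ^ 'n mod_ring) set"
  assumes n: "n = CARD('n)" "n \<ge> 3"
    and lam: "lam > 0"
    and Q: "Q = cyclic_field (cubic b c)"
    and contr: "contracting Q"
    and flow:
      "f = sphere_field Q \<and> M = sphere 0 1 \<and> \<psi> = id \<or>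
       f = (\<lambda>x. lam *\<^sub>R x + Q x) \<and> attracting_invariant_sphere f M \<and>
         topological_equivalence (sphere_field Q) (sphere 0 1) f M \<psi>"
  shows
    "(b\<^sup>2 + 4 * (c + 1) < 0 \<or> (b, c) = (0, -1) \<longrightarrow>
        (\<exists>\<C>. heteroclinic_network f M \<C> \<and> network_equilibria \<C> = \<psi> ` poles \<and>
           (\<forall>i. \<forall>p \<in> {axis (i + 1) 1, - axis (i + 1) 1}. \<forall>p' \<in> {axis i 1, - axis i 1}.
              \<exists>x. (\<psi> p, x, \<psi> p') \<in> network_connections \<C>)))
     \<and>
     (b\<^sup>2 + 4 * (c + 1) \<ge> 0 \<and> c \<le> -1 \<and> (b, c) \<noteq> (0, -1) \<longrightarrow>
        card (cycles_among f M (\<psi> ` poles)) \<in> {1, 2} \<and>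
        (let A = cyclic_list (map (\<lambda>i. \<psi> (axis (of_nat i) 1)) (rev [1..<n+1]));
             B = cyclic_list (map (\<lambda>i. \<psi> (- axis (of_nat i) 1)) (rev [1..<n+1]))
         in b < 0 \<longrightarrow> A \<noteq> B \<and> cycles_among f M (\<psi> ` poles) = {A, B}) \<and>
        (let A = cyclic_list (map (\<lambda>i. \<psi> ((-1) ^ (n - i) *\<^sub>R axis (of_nat i) 1)) (rev [1..<n+1]));
             B = cyclic_list (map (\<lambda>i. \<psi> (- ((-1) ^ (n - i) *\<^sub>R axis (of_nat i) 1))) (rev [1..<n+1]))
         in b > 0 \<and> even n \<longrightarrow> A \<noteq> B \<and> cycles_among f M (\<psi> ` poles) = {A, B}) \<and>
        (b > 0 \<and> odd n \<longrightarrow>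
           cycles_among f M (\<psi> ` poles) =
             {cyclic_list
                (map (\<lambda>i. \<psi> ((-1) ^ (n - i) *\<^sub>R axis (of_nat i) 1)) (rev [1..<n+1]) @
                 map (\<lambda>i. \<psi> (- ((-1) ^ (n - i) *\<^sub>R axis (of_nat i) 1))) (rev [1..<n+1]))}))"
    (is "(?small \<longrightarrow> ?network) \<and> (?large \<longrightarrow> ?cycles)")
proof -
  let ?g = "sphere_field Q" and ?S = "sphere 0 1 :: (real ^ 'n mod_ring) set"
  have n3: "CARD('n) \<ge> 3" using n by simp
  have equiv: "topological_equivalence ?g ?S f M \<psi>"
    using flow topological_equivalence_id by blast
  have inj: "inj_on \<psi> poles"
  proof -
    obtain h' where "homeomorphism ?S M \<psi> h'"
      using equiv by (auto simp: topological_equivalence_def)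
    then have "inj_on \<psi> ?S" by (metis homeomorphism_def inj_on_inverseI)
    then show ?thesis using poles_subset_sphere inj_on_subset by blast
  qed
  have conn_iff: "(\<exists>y. heteroclinic_connection f M (\<psi> p) (\<psi> q) y) \<longleftrightarrow>
      (\<exists>x. heteroclinic_connection ?g ?S p q x)" if "p \<in> poles" "q \<in> poles" for p q
    using topological_equivalence_connection[OF equiv] that poles_subset_sphere by blast
  have pole: "s *\<^sub>R axis i 1 \<in> poles" if "s \<in> {1, - 1}" for s and i :: "'n mod_ring"
    using that unfolding poles_iff by blast
  have conn: "\<exists>y. heteroclinic_connection f M (\<psi> ((\<sigma> * \<tau>) *\<^sub>R axis (i + 1) 1)) (\<psi> (\<tau> *\<^sub>R axis i 1)) y"
    if "\<sigma> \<in> {1, - 1}" "\<tau> \<in> {1, - 1}" "\<And>r. r > 0 \<Longrightarrow> c + 1 + b * (\<sigma> * r) - r\<^sup>2 < 0" for \<sigma> \<tau> i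
  proof -
    have "\<sigma> * \<tau> \<in> {1, - 1}" using that(1,2) by auto
    then show ?thesis
      using conn_iff[OF pole pole[OF that(2)]] planar_connection_exists[OF n3 that]
      unfolding Q by metis
  qed
  have "?network" if small: "?small"
  proof -
    \<comment> \<open>Four times the quadratic equals \<open>b\<^sup>2 + 4 * (c + 1)\<close> minus
      the square of \<open>2 * (\<sigma> * r) - b\<close>; for \<open>(b, c) = (0, - 1)\<close> the
      quadratic is \<open>- r\<^sup>2\<close>.\<close>
    have neg: "c + 1 + b * (\<sigma> * r) - r\<^sup>2 < 0" if "r > 0" "\<sigma> \<in> {1, - 1}" for \<sigma> r
    proof -
      have "(2 * (\<sigma> * r) - b)\<^sup>2 = 4 * r\<^sup>2 - 4 * (b * (\<sigma> * r)) + b\<^sup>2"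
        using that(2) by (auto simp: power2_eq_square algebra_simps)
      then have square: "4 * (b * (\<sigma> * r)) \<le> 4 * r\<^sup>2 + b\<^sup>2"
        using zero_le_power2[of "2 * (\<sigma> * r) - b"] by linarith
      show ?thesis
      proof (cases "(b, c) = (0, - 1)")
        case True
        then show ?thesis using that(1) by simp
      next
        case False
        then have "b\<^sup>2 + 4 * (c + 1) < 0" using small by blast
        moreover have "c + 1 + X - r\<^sup>2 < 0" if "b\<^sup>2 + 4 * (c + 1) < 0" "4 * X \<le> 4 * r\<^sup>2 + b\<^sup>2" for X
          using that by argo
        ultimately show ?thesis using square by blast
      qed
    qed
    define sg where "sg = (\<lambda>s. if s then 1 else - 1 :: real)"
    have sg: "sg s \<in> {1, - 1}" for s by (simp add: sg_def)
    define V where "V = (\<lambda>s (i :: 'n mod_ring). \<psi> (sg s *\<^sub>R axis i 1))"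
    have V_inj: "V s i = V s' j \<longleftrightarrow> s = s' \<and> i = j" for s s' i j
    proof -
      have "V s i = V s' j \<longleftrightarrow> sg s *\<^sub>R axis i (1::real) = sg s' *\<^sub>R axis j 1"
        unfolding V_def using inj_on_eq_iff[OF inj pole pole] sg by blast
      then show ?thesis using scaleR_axis_eq_iff[of "sg s" i "sg s'" j]
        by (auto simp: sg_def split: if_splits)
    qed
    have V_conn: "\<exists>x. heteroclinic_connection f M (V s (i + 1)) (V s' i) x" for i s s'
    proof -
      have eq: "(sg s * sg s') * sg s' = sg s" and prod: "sg s * sg s' \<in> {1, - 1}"
        by (cases s; cases s'; simp add: sg_def)+
      show ?thesis using conn[OF prod sg neg[OF _ prod], of s' i] unfolding eq V_def .
    qed
    obtain \<C> where \<C>: "heteroclinic_network f M \<C>"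
      "network_equilibria \<C> = (\<Union>i. {V True i, V False i})"
      "\<And>i s s'. \<exists>x. (V s (i + 1), x, V s' i) \<in> network_connections \<C>"
      using sign_choice_network[of V f M, OF V_inj V_conn] by auto
    have V: "V True i = \<psi> (axis i 1)" "V False i = \<psi> (- axis i 1)" for i
      by (auto simp: V_def sg_def)
    have "network_equilibria \<C> = \<psi> ` poles"
      unfolding \<C>(2) V poles_def by auto
    moreover have "\<exists>x. (\<psi> p, x, \<psi> p') \<in> network_connections \<C>"
      if "p \<in> {axis (i + 1) 1, - axis (i + 1) 1}" "p' \<in> {axis i 1, - axis i 1}" for p p' i
    proof -
      have "\<psi> p = V (p = axis (i + 1) 1) (i + 1)" "\<psi> p' = V (p' = axis i 1) i"
        using that V[of "i + 1"] V[of i] by (cases "p = axis (i + 1) 1"; cases "p' = axis i 1"; simp)+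
      then show ?thesis using \<C>(3)[of "p = axis (i + 1) 1" i "p' = axis i 1"] by simp
    qed
    ultimately show ?thesis using \<C>(1) by (intro exI[of _ \<C>]) simp
  qed
  moreover have "?cycles" if large: "?large"
  proof -
    have b: "b \<noteq> 0" using large by auto
    \<comment> \<open>The sign of the ratio that makes the linear term negative; with
      \<open>c \<le> - 1\<close> the quadratic is then negative on all ratios of this sign.\<close>
    define \<sigma> where "\<sigma> = (if b < 0 then 1 else - 1 :: real)"
    have \<sigma>: "\<sigma> \<in> {1, - 1}" and b\<sigma>: "b * \<sigma> = - \<bar>b\<bar>" using b by (auto simp: \<sigma>_def)
    have neg: "c + 1 + b * (\<sigma> * r) - r\<^sup>2 < 0" if "r > 0" for r
    proof -
      have "b * (\<sigma> * r) = - (\<bar>b\<bar> * r)" using b\<sigma> by (simp add: mult.assoc[symmetric])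
      moreover have "\<bar>b\<bar> * r > 0" using b that by simp
      moreover have "r\<^sup>2 > 0" using that by simp
      moreover have "c \<le> - 1" using large by blast
      ultimately show ?thesis by linarith
    qed
    \<comment> \<open>The modulus of a root of sign \<open>- \<sigma>\<close>: real because the
      discriminant is nonnegative, nonzero because \<open>b \<noteq> 0\<close>. It blocks all
      connections of that sign.\<close>
    define r0 where "r0 = (\<bar>b\<bar> + sqrt (b\<^sup>2 + 4 * (c + 1))) / 2"
    have r0: "r0 > 0" using b large by (simp add: r0_def add_pos_nonneg)
    have root: "c + 1 + b * (- \<sigma> * r0) - r0\<^sup>2 = 0"
    proof -
      have "2 * r0 - \<bar>b\<bar> = sqrt (b\<^sup>2 + 4 * (c + 1))"
        by (simp add: r0_def add_divide_distrib)
      then have "(2 * r0 - \<bar>b\<bar>)\<^sup>2 = b\<^sup>2 + 4 * (c + 1)"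
        by (simp only: real_sqrt_pow2[OF conjunct1[OF large]])
      then have "(2 * r0 - \<bar>b\<bar>)\<^sup>2 = b\<^sup>2 + 4 * c + 4" by simp
      moreover have "(2 * r0 - \<bar>b\<bar>)\<^sup>2 = 4 * r0\<^sup>2 - 4 * (\<bar>b\<bar> * r0) + b\<^sup>2"
        by (simp add: power2_eq_square algebra_simps)
      moreover have "b * (- \<sigma> * r0) = \<bar>b\<bar> * r0" using b\<sigma> by (simp add: mult.assoc[symmetric])
      ultimately show ?thesis by linarith
    qed
    define R where "R = (\<lambda>p q. p \<in> \<psi> ` poles \<and> q \<in> \<psi> ` poles \<and>
      (\<exists>x. heteroclinic_connection f M p q x))"
    have cycles: "cycles_among f M (\<psi> ` poles) = cyclic_list ` {ps. rel_cycle R ps}"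
      unfolding R_def by (rule cycles_among_rel_cycle)
    have R: "R (\<psi> ((\<sigma> * \<tau>) *\<^sub>R axis (i + 1) 1)) (\<psi> (\<tau> *\<^sub>R axis i 1))" if "\<tau> \<in> {1, - 1}" for i \<tau>
    proof -
      have "\<sigma> * \<tau> \<in> {1, - 1}" using \<sigma> that by auto
      then have "\<psi> ((\<sigma> * \<tau>) *\<^sub>R axis (i + 1) 1) \<in> \<psi> ` poles"
        by (intro imageI pole)
      moreover have "\<psi> (\<tau> *\<^sub>R axis i 1) \<in> \<psi> ` poles"
        using that by (intro imageI pole)
      ultimately show ?thesis
        unfolding R_def using conn[OF \<sigma> that neg, of i] by simp
    qed
    \<comment> \<open>A connection of ratio sign \<open>- \<sigma>\<close> would have to cross the
      root given by \<open>r0\<close>; the remaining sign determines the predecessor.\<close>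
    have R_pred: "p = \<psi> ((\<sigma> * \<tau>) *\<^sub>R axis (i + 1) 1)"
      if Rp: "R p (\<psi> (\<tau> *\<^sub>R axis i 1))" and \<tau>: "\<tau> \<in> {1, - 1}" for p i \<tau>
    proof -
      obtain p0 where p0: "p = \<psi> p0" "p0 \<in> poles" using Rp by (auto simp: R_def)
      then obtain x where "heteroclinic_connection ?g ?S p0 (\<tau> *\<^sub>R axis i 1) x"
        using Rp conn_iff[OF p0(2) pole[OF \<tau>], of i] unfolding R_def p0(1) by blast
      from connection_between_poles[OF n3 \<tau> p0(2) this[unfolded Q]]
      obtain \<sigma>' where \<sigma>': "\<sigma>' \<in> {1, - 1}" "p0 = (\<sigma>' * \<tau>) *\<^sub>R axis (i + 1) 1"
        "\<forall>r>0. c + 1 + b * (\<sigma>' * r) - r\<^sup>2 \<noteq> 0"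
        by blast
      have "c + 1 + b * (\<sigma>' * r0) - r0\<^sup>2 \<noteq> 0" using \<sigma>'(3) r0 by blast
      then have "\<sigma>' \<noteq> - \<sigma>" using root by auto
      then have "\<sigma>' = \<sigma>" using \<sigma> \<sigma>'(1) by auto
      then show ?thesis using p0 \<sigma>'(2) by simp
    qed
    have det: "p = p'" if R: "R p q" "R p' q" for p p' q
    proof -
      obtain q0 where "q = \<psi> q0" "q0 \<in> poles" using R(1) by (auto simp: R_def)
      then obtain i \<tau> where "\<tau> \<in> {1, - 1}" "q = \<psi> (\<tau> *\<^sub>R axis i 1)"
        unfolding poles_iff by blast
      then show ?thesis using R_pred[of p \<tau> i] R_pred[of p' \<tau> i] R by simp
    qed
    have dom: "p \<in> \<psi> ` poles" if "R p q" for p q using that by (simp add: R_def)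
    have alt: "(- 1) ^ k \<in> {1, - 1 :: real}" for k by (cases "even k") auto
    have alt_step: "(- 1) ^ (n - Suc i) = - ((- 1 :: real) ^ (n - i))" if "i < n" for i
    proof -
      have "n - i = Suc (n - Suc i)" using that by simp
      then show ?thesis by simp
    qed
    have neg_case: "cyclic_list (map (\<lambda>i. \<psi> (axis (of_nat i) 1)) (rev [1..<n+1])) \<noteq>
        cyclic_list (map (\<lambda>i. \<psi> (- axis (of_nat i) 1)) (rev [1..<n+1])) \<and>
      cycles_among f M (\<psi> ` poles) =
        {cyclic_list (map (\<lambda>i. \<psi> (axis (of_nat i) 1)) (rev [1..<n+1])),
         cyclic_list (map (\<lambda>i. \<psi> (- axis (of_nat i) 1)) (rev [1..<n+1]))}" if "b < 0"
    proof -
      have "\<sigma> = 1" using that by (simp add: \<sigma>_def)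
      then show ?thesis
        using two_sign_cycles[where \<psi> = \<psi> and R = R and \<sigma> = \<sigma> and \<epsilon> = "\<lambda>_. 1", OF inj n(1) R det dom]
        unfolding cycles scaleR_one by simp
    qed
    have even_case: "cyclic_list (map (\<lambda>i. \<psi> ((- 1) ^ (n - i) *\<^sub>R axis (of_nat i) 1)) (rev [1..<n+1])) \<noteq>
        cyclic_list (map (\<lambda>i. \<psi> (- ((- 1) ^ (n - i) *\<^sub>R axis (of_nat i) 1))) (rev [1..<n+1])) \<and>
      cycles_among f M (\<psi> ` poles) =
        {cyclic_list (map (\<lambda>i. \<psi> ((- 1) ^ (n - i) *\<^sub>R axis (of_nat i) 1)) (rev [1..<n+1])),
         cyclic_list (map (\<lambda>i. \<psi> (- ((- 1) ^ (n - i) *\<^sub>R axis (of_nat i) 1))) (rev [1..<n+1]))}"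
      if "b > 0" "even n"
      unfolding cycles
    proof (rule two_sign_cycles[where \<psi> = \<psi> and R = R and \<sigma> = \<sigma> and \<epsilon> = "\<lambda>i. (- 1) ^ (n - i)",
          OF inj n(1) R det dom alt])
      have \<sigma>1: "\<sigma> = - 1" using that by (simp add: \<sigma>_def)
      show "(- 1) ^ (n - Suc i) = \<sigma> * (- 1) ^ (n - i)" if "i < n" for i
        using alt_step[OF that] \<sigma>1 by simp
      \<comment> \<open>For even \<open>n\<close> the alternating signs close up after one round:
        index 1 carries the sign opposite to that of index \<open>n\<close>.\<close>
      have "odd (n - 1)" using \<open>even n\<close> n(2) by simp
      then show "(- 1) ^ (n - 1) = \<sigma> * (- 1) ^ (n - n)" using \<sigma>1 by simp
    qed
    have odd_case: "cycles_among f M (\<psi> ` poles) =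
        {cyclic_list
          (map (\<lambda>i. \<psi> ((- 1) ^ (n - i) *\<^sub>R axis (of_nat i) 1)) (rev [1..<n+1]) @
           map (\<lambda>i. \<psi> (- ((- 1) ^ (n - i) *\<^sub>R axis (of_nat i) 1))) (rev [1..<n+1]))}"
      if "b > 0" "odd n"
    proof -
      have "\<sigma> = - 1" using that by (simp add: \<sigma>_def)
      note R' = R[unfolded this]
      show ?thesis unfolding cycles
        by (rule one_alternating_cycle[where \<psi> = \<psi> and R = R, OF inj n(1) that(2) R' det dom])
    qed
    have "card (cycles_among f M (\<psi> ` poles)) \<in> {1, 2}"
    proof (cases "b < 0")
      case True
      then show ?thesis using neg_case by (simp del: upt_Suc)
    next
      case False
      then have "b > 0" using b by simp
      then show ?thesis using even_case odd_case by (cases "even n") (simp_all del: upt_Suc)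
    qed
    then show ?thesis unfolding Let_def using neg_case even_case odd_case by blast
  qed
  ultimately show ?thesis by blast
qed

end
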